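(* For every integer $m\ge 1$, the Euler characteristic of the configuration space of $3$ unordered points on the generalized theta graph $\Theta_m$ is $$\chi(\mathrm{Conf}_3(\Theta_m)) = \frac{m(m-2)(m-7)}{6}.$$
   Context: For a finite graph $\Gamma$ (viewed as a topological space, a finite 1-dimensional CW complex), the configuration space of $n$ unordered points is $\mathrm{Conf}_n(\Gamma) = (\Gamma^n - \Delta)/S_n$, where $\Delta = \{(x_1,\dots,x_n) : x_i = x_j \text{ for some } i\neq j\}$ and the symmetric group $S_n$ permutes the factors. This space is homotopy equivalent to a finite CW complex, so its Euler characteristic is defined. The generalized theta graph $\Theta_m$ is the suspension of $m$ points: two vertices $a_1,a_2$ joined by $m$ arcs that are disjoint except at their endpoints. *)

theory Defs
  imports "HOL-Homology.Homology" "HOL-Combinatorics.Permutations" "HOL-Library.Extended_Nat"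
begin

section \<open>Quotient topologies\<close>

definition quotient_topology :: "'a topology \<Rightarrow> ('a \<Rightarrow> 'b) \<Rightarrow> 'b topology" where
  "quotient_topology X q =
     topology (\<lambda>U. U \<subseteq> q ` topspace X \<and> openin X {x \<in> topspace X. q x \<in> U})"

lemma istopology_quotient:
  "istopology (\<lambda>U. U \<subseteq> q ` topspace X \<and> openin X {x \<in> topspace X. q x \<in> U})"
proof -
  have Int: "openin X {x \<in> topspace X. q x \<in> S \<inter> T}"
    if "openin X {x \<in> topspace X. q x \<in> S}" "openin X {x \<in> topspace X. q x \<in> T}" for S T
  proof -
    have "{x \<in> topspace X. q x \<in> S \<inter> T} = {x \<in> topspace X. q x \<in> S} \<inter> {x \<in> topspace X. q x \<in> T}"
      by auto
    then show ?thesis using that by (simp only: openin_Int)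
  qed
  have Un: "openin X {x \<in> topspace X. q x \<in> \<Union>K}"
    if "\<And>S. S \<in> K \<Longrightarrow> openin X {x \<in> topspace X. q x \<in> S}" for K
  proof -
    have "{x \<in> topspace X. q x \<in> \<Union>K} = (\<Union>S\<in>K. {x \<in> topspace X. q x \<in> S})"
      by auto
    then show ?thesis using that by (auto simp only: intro!: openin_Union)
  qed
  show ?thesis
    unfolding istopology_def
    by (intro conjI allI impI) (use Int in blast, use Int in blast, use Un in blast, use Un in blast)
qed

lemma openin_quotient_topology:
  "openin (quotient_topology X q) U \<longleftrightarrow>
     U \<subseteq> q ` topspace X \<and> openin X {x \<in> topspace X. q x \<in> U}"
  unfolding quotient_topology_def by (simp only: topology_inverse'[OF istopology_quotient])

lemma topspace_quotient_topology: "topspace (quotient_topology X q) = q ` topspace X"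
proof -
  have "{x \<in> topspace X. q x \<in> q ` topspace X} = topspace X"
    by auto
  then have "openin (quotient_topology X q) (q ` topspace X)"
    unfolding openin_quotient_topology by simp
  then have "q ` topspace X \<subseteq> topspace (quotient_topology X q)"
    by (rule openin_subset)
  moreover have "topspace (quotient_topology X q) \<subseteq> q ` topspace X"
    using openin_topspace[of "quotient_topology X q"] unfolding openin_quotient_topology by (rule conjunct1)
  ultimately show ?thesis
    by (rule subset_antisym[rotated])
qed

lemma quotient_map_quotient_topology: "quotient_map X (quotient_topology X q) q"
  by (simp add: quotient_map_def topspace_quotient_topology openin_quotient_topology)


section \<open>Suspensions and generalized theta graphs\<close>

text \<open>
  The suspension of \<open>X\<close> is \<open>X \<times> [0,1]\<close> with \<open>X \<times> {0}\<close> and \<open>X \<times> {1}\<close> each collapsed to a point.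
  The only points of the datatype that belong to the resulting space are the two poles and
  the points \<open>Between x t\<close> with \<open>x\<close> in \<open>X\<close> and \<open>0 < t < 1\<close>.
\<close>

datatype 'a suspension_point = South | North | Between 'a real

fun suspension_proj :: "'a \<times> real \<Rightarrow> 'a suspension_point" where
  "suspension_proj (x, t) = (if t = 0 then South else if t = 1 then North else Between x t)"

definition suspension :: "'a topology \<Rightarrow> 'a suspension_point topology" where
  "suspension X = quotient_topology (prod_topology X (top_of_set {0..1})) suspension_proj"

definition theta_graph :: "nat \<Rightarrow> nat suspension_point topology" where
  "theta_graph m = suspension (discrete_topology {..<m})"


section \<open>Unordered configuration spaces\<close>

definition ordered_conf :: "nat \<Rightarrow> 'a topology \<Rightarrow> (nat \<Rightarrow> 'a) topology" where
  "ordered_conf n X =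
     subtopology (product_topology (\<lambda>_. X) {..<n}) {x. inj_on x {..<n}}"

text \<open>
  The orbit of an \<open>n\<close>-tuple under the symmetric group on \<open>{..<n}\<close>. Permutations fix everything
  outside \<open>{..<n}\<close>, so the orbit of an extensional function consists of extensional functions.
\<close>

definition perm_orbit :: "nat \<Rightarrow> (nat \<Rightarrow> 'a) \<Rightarrow> (nat \<Rightarrow> 'a) set" where
  "perm_orbit n x = {x \<circ> \<sigma> | \<sigma>. \<sigma> permutes {..<n}}"

definition unordered_conf :: "nat \<Rightarrow> 'a topology \<Rightarrow> (nat \<Rightarrow> 'a) set topology" where
  "unordered_conf n X = quotient_topology (ordered_conf n X) (perm_orbit n)"


section \<open>Euler characteristics\<close>

definition int_independent :: "('a, 'b) monoid_scheme \<Rightarrow> 'a set \<Rightarrow> bool" where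
  "int_independent G S \<longleftrightarrow> finite S \<and> S \<subseteq> carrier G \<and>
     (\<forall>c :: 'a \<Rightarrow> int. finprod G (\<lambda>x. x [^]\<^bsub>G\<^esub> c x) S = \<one>\<^bsub>G\<^esub> \<longrightarrow> (\<forall>x\<in>S. c x = 0))"

text \<open>
  The rank of an abelian group, i.e. the dimension of its tensor product with the rationals;
  it is \<open>\<infinity>\<close> if there are arbitrarily large finite independent sets.
\<close>

definition abelian_rank :: "('a, 'b) monoid_scheme \<Rightarrow> enat" where
  "abelian_rank G = (SUP S \<in> {S. int_independent G S}. enat (card S))"

definition betti_number :: "nat \<Rightarrow> 'a topology \<Rightarrow> enat" where
  "betti_number p X = abelian_rank (homology_group (int p) X)"

definition euler_characteristic_defined :: "'a topology \<Rightarrow> bool" where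
  "euler_characteristic_defined X \<longleftrightarrow>
     (\<forall>p. betti_number p X \<noteq> \<infinity>) \<and> finite {p. betti_number p X \<noteq> 0}"

text \<open>Meaningful only if \<open>euler_characteristic_defined X\<close> holds.\<close>

definition euler_characteristic :: "'a topology \<Rightarrow> int" where
  "euler_characteristic X =
     (\<Sum>p | betti_number p X \<noteq> 0. (-1) ^ p * int (the_enat (betti_number p X)))"

end

(*
  Write U1 for the configurations avoiding the south pole and V1 for those with a strictly lowest
  point, measured by the height along the suspension; U2 and V2 are the analogues for the north pole
  and a strictly highest point. Each pair is an open cover, so by Mayer-Vietoris the Euler
  characteristic is an alternating sum over the nine intersections A \<inter> B with A one of U1, V1,
  U1 \<inter> V1 and B one of U2, V2, U2 \<inter> V2. A piece with a strictly lowest or highest point retracts by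
  sliding this point to its pole, if that is allowed; the other points stay inside the edges and are
  ordered lexicographically by edge and height. Hence every piece is a finite disjoint union of open
  cells, each contractible by a linear motion of the heights, and its Euler characteristic is the
  number of edge labellings. Over the integers, Mayer-Vietoris follows from additivity of the rank
  along the long exact sequence of a pair together with excision.
*)

theory Submission
  imports Defs
begin

text \<open>The poles are the obstacle. A point at a pole lies on no particular edge, so it can
  neither carry an edge label nor be moved linearly into an edge. The covers are chosen so that at
  most one point of a configuration may reach a given pole, and that point is drawn to the pole
  instead of away from it. An occupied pole is automatically the strict extreme, which is why U1 and
  V1 cover; strictness is what makes V1 open. In V1 the lowest point can pass from edge to edge
  through the pole, so its label is no invariant and only one choice is left; in U1 \<inter> V1 the
  pole is forbidden and \<open>m\<close> choices remain. Points that are not singled out contribute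
  weakly increasing tuples of labels. These three kinds of factor produce all the counts. No two
  points collide during a motion because the target heights increase in the same order in which the
  points are listed. Ranks are defined by integer relations inside a group, so rank-nullity is
  proved directly, with multiplication by a nonzero integer in place of division.\<close>

section \<open>Ranks of abelian groups\<close>

text \<open>Independence is tested in the ambient group, so kernels and images can be measured as
  plain subsets of a carrier, without forming subgroups.\<close>

definition sub_rank :: "('a, 'b) monoid_scheme \<Rightarrow> 'a set \<Rightarrow> enat" where
  "sub_rank G A = (SUP S \<in> {S. int_independent G S \<and> S \<subseteq> A}. enat (card S))"

lemma abelian_rank_eq_sub_rank: "abelian_rank G = sub_rank G (carrier G)"
  unfolding abelian_rank_def sub_rank_def int_independent_def by (rule SUP_cong) auto

lemma card_le_sub_rank: "int_independent G S \<Longrightarrow> S \<subseteq> A \<Longrightarrow> enat (card S) \<le> sub_rank G A"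
  unfolding sub_rank_def by (rule SUP_upper) auto

lemma sub_rank_le: "(\<And>S. int_independent G S \<Longrightarrow> S \<subseteq> A \<Longrightarrow> enat (card S) \<le> r) \<Longrightarrow> sub_rank G A \<le> r"
  unfolding sub_rank_def by (rule SUP_least) auto

lemma int_independent_empty: "int_independent G {}"
  by (simp add: int_independent_def)

text \<open>If \<open>c\<close> is finite, a fixed element of one set bounds the other one. Both
  sets are then finite and their suprema are maxima, attained by elements to which \<open>le\<close>
  applies.\<close>

lemma enat_Sup_add_le:
  fixes A B :: "enat set"
  assumes "A \<noteq> {}" "B \<noteq> {}" and le: "\<And>a b. a \<in> A \<Longrightarrow> b \<in> B \<Longrightarrow> a + b \<le> c"
  shows "Sup A + Sup B \<le> c"
proof (cases c)
  case (enat n)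
  obtain a0 b0 where "a0 \<in> A" "b0 \<in> B"
    using assms by blast
  then have "\<And>a. a \<in> A \<Longrightarrow> a \<le> enat n" "\<And>b. b \<in> B \<Longrightarrow> b \<le> enat n"
    using le[of _ b0] le[of a0] enat by (metis add_increasing2 order_refl order_trans zero_le add.commute)+
  then have "finite A" "finite B"
    using finite_enat_bounded by blast+
  then show ?thesis
    using assms by (simp add: Sup_enat_def)
qed simp

context comm_group
begin

lemma finprod_int_pow:
  assumes "finite I" "g \<in> I \<rightarrow> carrier G"
  shows "finprod G g I [^] (n::int) = finprod G (\<lambda>i. g i [^] n) I"
  using assms by (induction I rule: finite_induct) (auto simp: int_pow_distrib Pi_iff)

lemma finprod_swap:
  assumes "finite I" "finite J" "\<And>i j. i \<in> I \<Longrightarrow> j \<in> J \<Longrightarrow> g i j \<in> carrier G"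
  shows "finprod G (\<lambda>i. finprod G (g i) J) I = finprod G (\<lambda>j. finprod G (\<lambda>i. g i j) I) J"
  using assms
proof (induction I rule: finite_induct)
  case (insert x F)
  have "finprod G (\<lambda>i. finprod G (g i) J) (insert x F)
      = finprod G (g x) J \<otimes> finprod G (\<lambda>j. finprod G (\<lambda>i. g i j) F) J"
    using insert by (subst finprod_insert) (auto intro!: finprod_closed)
  also have "\<dots> = finprod G (\<lambda>j. g x j \<otimes> finprod G (\<lambda>i. g i j) F) J"
    using insert by (subst finprod_multf) (auto intro!: finprod_closed)
  also have "\<dots> = finprod G (\<lambda>j. finprod G (\<lambda>i. g i j) (insert x F)) J"
    using insert by (intro finprod_cong') (auto intro!: finprod_closed m_closed)
  finally show ?case .
qed simp

lemma finprod_int_pow_sum: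
  assumes "finite I" "a \<in> carrier G"
  shows "finprod G (\<lambda>i. a [^] (c i :: int)) I = a [^] sum c I"
  using assms by (induction I rule: finite_induct) (auto simp: int_pow_mult)

lemma finprod_delta:
  assumes "finite I" "i \<in> I" "g i \<in> carrier G"
  shows "finprod G (\<lambda>j. g j [^] (if j = i then n else 0 :: int)) I = g i [^] n"
proof -
  have "finprod G (\<lambda>j. g j [^] (if j = i then n else 0 :: int)) I
      = finprod G (\<lambda>j. if i = j then g j [^] n else \<one>) I"
    using assms by (intro finprod_cong') auto
  also have "\<dots> = g i [^] n"
  proof -
    have "I = insert i (I - {i})" using assms by auto
    then have "finprod G (\<lambda>j. if i = j then g j [^] n else \<one>) I
       = finprod G (\<lambda>j. if i = j then g j [^] n else \<one>) (insert i (I - {i}))"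
      by simp
    also have "\<dots> = g i [^] n \<otimes> finprod G (\<lambda>j. if i = j then g j [^] n else \<one>) (I - {i})"
      using assms by (subst finprod_insert) auto
    also have "finprod G (\<lambda>j. if i = j then g j [^] n else \<one>) (I - {i}) = \<one>"
      by (rule finprod_one_eqI) auto
    finally show ?thesis using assms by simp
  qed
  finally show ?thesis .
qed

text \<open>\<open>int_independent\<close> concerns sets, whereas the constructions below give
  indexed families. A repeated value would satisfy the relation with coefficients 1 and -1 at its
  two indices, so an independent family is injective.\<close>

lemma int_independent_image:
  assumes "finite I" "g \<in> I \<rightarrow> carrier G"
    and indep: "\<And>c :: _ \<Rightarrow> int. finprod G (\<lambda>i. g i [^] c i) I = \<one> \<Longrightarrow> \<forall>i\<in>I. c i = 0"
  shows "int_independent G (g ` I) \<and> card (g ` I) = card I"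
proof -
  have inj: "inj_on g I"
  proof (rule inj_onI, rule ccontr)
    fix i j assume ij: "i \<in> I" "j \<in> I" "g i = g j" "i \<noteq> j"
    let ?c = "\<lambda>k. (if k = i then 1 else 0) + (if k = j then - 1 else 0) :: int"
    have "finprod G (\<lambda>k. g k [^] ?c k) I
        = finprod G (\<lambda>k. g k [^] (if k = i then 1 else 0 :: int)) I
          \<otimes> finprod G (\<lambda>k. g k [^] (if k = j then - 1 else 0 :: int)) I"
      using assms(1,2)
      by (subst finprod_multf[symmetric]) (auto intro!: finprod_cong' simp: Pi_iff simp del: finprod_multf simp flip: int_pow_mult)
    also have "\<dots> = g i [^] (1::int) \<otimes> g j [^] (- 1 :: int)"
      using ij assms by (subst (1 2) finprod_delta) auto
    also have "\<dots> = \<one>"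
    proof -
      have "g i \<in> carrier G" using ij(1) assms(2) by auto
      then show ?thesis unfolding ij(3)[symmetric] int_pow_mult[OF \<open>g i \<in> carrier G\<close>, symmetric] by simp
    qed
    finally have "?c i = 0"
      using indep[of ?c] ij by blast
    with ij show False by simp
  qed
  have "\<forall>x\<in>g ` I. c x = 0" if "finprod G (\<lambda>x. x [^] (c x :: int)) (g ` I) = \<one>" for c
  proof -
    have "finprod G (\<lambda>x. x [^] c x) (g ` I) = finprod G (\<lambda>i. g i [^] c (g i)) I"
      using assms inj by (intro finprod_reindex) auto
    then show ?thesis
      using indep[of "c \<circ> g"] that by auto
  qed
  then show ?thesis
    using assms inj unfolding int_independent_def by (auto simp: card_image)
qed

text \<open>The singleton of the unit is itself dependent, through the relation with coefficient 1,
  so only the empty set counts.\<close>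

lemma sub_rank_one: "sub_rank G {\<one>} = 0"
proof -
  have "enat (card S) \<le> 0" if S: "int_independent G S" "S \<subseteq> {\<one>}" for S
  proof -
    have "finprod G (\<lambda>x. x [^] (1::int)) S = \<one>"
      using S by (intro finprod_one_eqI) auto
    then have "S = {}"
      using spec[OF conjunct2[OF conjunct2[OF S(1)[unfolded int_independent_def]]], of "\<lambda>_. 1"] by auto
    then show ?thesis by (simp add: zero_enat_def)
  qed
  then show ?thesis
    using sub_rank_le[of G "{\<one>}" 0] by simp
qed

end

section \<open>Rank-nullity for homomorphisms of abelian groups\<close>

lemma hom_finprod:
  assumes "comm_group G" "comm_group H" "h \<in> hom G H" "finite I" "g \<in> I \<rightarrow> carrier G"
  shows "h (finprod G g I) = finprod H (\<lambda>i. h (g i)) I"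
proof -
  interpret G: comm_group G by fact
  interpret H: comm_group H by fact
  interpret group_hom G H h
    using assms by unfold_locales
  show ?thesis
    using assms(4,5) by (induction I rule: finite_induct) (auto simp: Pi_iff)
qed

text \<open>For the upper bound, an independent \<open>S\<close> is split into a maximal part
  \<open>T\<close> whose image stays independent and a rest that is corrected into the kernel. For
  the lower bound, lifts of an independent set in the image are joined to an independent set in the
  kernel.\<close>

lemma abelian_rank_hom:
  assumes G: "comm_group G" and H: "comm_group H" and h: "h \<in> hom G H"
  shows "abelian_rank G = sub_rank G (kernel G H h) + sub_rank H (h ` carrier G)"
proof (rule antisym)
  interpret G: comm_group G by fact
  interpret H: comm_group H by fact
  interpret group_hom G H h
    using assms by unfold_locales
  show "abelian_rank G \<le> sub_rank G (kernel G H h) + sub_rank H (h ` carrier G)"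
    unfolding abelian_rank_eq_sub_rank
  proof (rule sub_rank_le)
    fix S assume S: "int_independent G S" "S \<subseteq> carrier G"
    then have "finite S"
      by (simp add: int_independent_def)
    define Q where "Q c T \<longleftrightarrow> finprod H (\<lambda>t. h t [^]\<^bsub>H\<^esub> (c t :: int)) T = \<one>\<^bsub>H\<^esub>" for c T
    define P where "P T \<longleftrightarrow> T \<subseteq> S \<and> (\<forall>c. Q c T \<longrightarrow> (\<forall>t\<in>T. c t = 0))" for T
    have "P {}" by (simp add: P_def)
    moreover have "\<forall>T. P T \<longrightarrow> card T < Suc (card S)"
      using \<open>finite S\<close> by (auto simp: P_def intro: card_mono le_imp_less_Suc)
    ultimately obtain T where T: "P T" and max: "\<And>T'. P T' \<Longrightarrow> card T' \<le> card T"
      using ex_has_greatest_nat[of P "{}" card] by metis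
    have hS: "h s \<in> carrier H" if "s \<in> S" for s
      using that S(2) by auto
    have TS: "T \<subseteq> S" and finT: "finite T" and Tc: "T \<subseteq> carrier G"
      using T S \<open>finite S\<close> by (auto simp: P_def intro: finite_subset)
    have hT: "h t \<in> carrier H" if "t \<in> T" for t
      using that TS hS by blast
    \<comment> \<open>By maximality of \<open>T\<close>, adding \<open>s\<close> creates a
      nontrivial relation between the images. The coefficient of \<open>s\<close> in it is nonzero,
      since otherwise the relation would live on \<open>T\<close> alone.\<close>
    have "\<exists>n c. n \<noteq> (0::int) \<and> h s [^]\<^bsub>H\<^esub> n \<otimes>\<^bsub>H\<^esub> finprod H (\<lambda>t. h t [^]\<^bsub>H\<^esub> (c t :: int)) T = \<one>\<^bsub>H\<^esub>"
      if s: "s \<in> S - T" for s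
    proof -
      have "\<not> P (insert s T)"
        using max[of "insert s T"] s finT by (metis DiffD2 Suc_n_not_le_n card_insert_disjoint)
      moreover have "insert s T \<subseteq> S"
        using s TS by blast
      ultimately have "\<not> (\<forall>c. Q c (insert s T) \<longrightarrow> (\<forall>t\<in>insert s T. c t = 0))"
        unfolding P_def by (simp only: simp_thms)
      then obtain c where "Q c (insert s T)" and nz: "\<exists>t\<in>insert s T. c t \<noteq> 0"
        by (metis (no_types))
      then have c: "finprod H (\<lambda>t. h t [^]\<^bsub>H\<^esub> c t) (insert s T) = \<one>\<^bsub>H\<^esub>"
        by (simp add: Q_def)
      have eq: "finprod H (\<lambda>t. h t [^]\<^bsub>H\<^esub> c t) (insert s T)
          = h s [^]\<^bsub>H\<^esub> c s \<otimes>\<^bsub>H\<^esub> finprod H (\<lambda>t. h t [^]\<^bsub>H\<^esub> c t) T"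
        using s finT hT hS by (intro H.finprod_insert) auto
      have "c s \<noteq> 0"
      proof
        assume "c s = 0"
        then have "Q c T"
          using eq c hT hS s \<open>c s = 0\<close> by (simp add: Q_def H.finprod_closed Pi_iff)
        then show False
          using T nz \<open>c s = 0\<close> unfolding P_def by blast
      qed
      then show ?thesis
        using c eq by (intro exI[of _ "c s"] exI[of _ c]) simp
    qed
    then obtain n c where n: "\<And>s. s \<in> S - T \<Longrightarrow> n s \<noteq> (0::int)"
      and nc: "\<And>s. s \<in> S - T \<Longrightarrow> h s [^]\<^bsub>H\<^esub> n s \<otimes>\<^bsub>H\<^esub> finprod H (\<lambda>t. h t [^]\<^bsub>H\<^esub> (c s t :: int)) T = \<one>\<^bsub>H\<^esub>"
      by metis
    \<comment> \<open>A nonzero power of \<open>s\<close>, corrected by elements of \<open>T\<close>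
      so that \<open>h\<close> kills it.\<close>
    define k where "k s = s [^]\<^bsub>G\<^esub> n s \<otimes>\<^bsub>G\<^esub> finprod G (\<lambda>t. t [^]\<^bsub>G\<^esub> c s t) T" for s
    have kc: "k s \<in> carrier G" if "s \<in> S - T" for s
      using that S Tc by (auto simp: k_def intro!: G.finprod_closed)
    have ker: "k s \<in> kernel G H h" if s: "s \<in> S - T" for s
    proof -
      have "h (k s) = h s [^]\<^bsub>H\<^esub> n s \<otimes>\<^bsub>H\<^esub> finprod H (\<lambda>t. h (t [^]\<^bsub>G\<^esub> c s t)) T"
      proof -
        have "s \<in> carrier G" "\<And>t. t \<in> T \<Longrightarrow> t \<in> carrier G"
          using s S Tc by auto
        then show ?thesis
          using finT by (simp add: k_def hom_mult hom_int_pow hom_finprod[OF G H h] G.finprod_closed Pi_iff)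
      qed
      also have "finprod H (\<lambda>t. h (t [^]\<^bsub>G\<^esub> c s t)) T = finprod H (\<lambda>t. h t [^]\<^bsub>H\<^esub> c s t) T"
        using Tc by (intro H.finprod_cong') (auto simp: hom_int_pow)
      finally show ?thesis
        using nc[OF s] kc[OF s] by (simp add: kernel_def)
    qed
    have indk: "\<forall>s\<in>S - T. d s = 0"
      if d: "finprod G (\<lambda>s. k s [^]\<^bsub>G\<^esub> (d s :: int)) (S - T) = \<one>\<^bsub>G\<^esub>" for d
    proof -
      \<comment> \<open>\<open>e\<close> collects the exponents of the original elements in the
        product of the powers of the \<open>k s\<close>. Independence of \<open>S\<close> makes them
        all vanish; outside \<open>T\<close> they are \<open>n x * d x\<close> with
        \<open>n x\<close> nonzero.\<close>
      define e where "e x = (if x \<in> T then \<Sum>s\<in>S - T. c s x * d s else n x * d x)" for x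
      have "finprod G (\<lambda>s. k s [^]\<^bsub>G\<^esub> d s) (S - T)
          = finprod G (\<lambda>s. s [^]\<^bsub>G\<^esub> (n s * d s) \<otimes>\<^bsub>G\<^esub> finprod G (\<lambda>t. t [^]\<^bsub>G\<^esub> (c s t * d s)) T) (S - T)"
      proof (rule G.finprod_cong'[OF refl])
        fix s assume s: "s \<in> S - T"
        have "k s [^]\<^bsub>G\<^esub> d s = (s [^]\<^bsub>G\<^esub> n s) [^]\<^bsub>G\<^esub> d s \<otimes>\<^bsub>G\<^esub> (finprod G (\<lambda>t. t [^]\<^bsub>G\<^esub> c s t) T) [^]\<^bsub>G\<^esub> d s"
          using s S Tc unfolding k_def by (intro G.int_pow_distrib) (auto intro!: G.finprod_closed)
        also have "(finprod G (\<lambda>t. t [^]\<^bsub>G\<^esub> c s t) T) [^]\<^bsub>G\<^esub> d s = finprod G (\<lambda>t. (t [^]\<^bsub>G\<^esub> c s t) [^]\<^bsub>G\<^esub> d s) T"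
          using finT Tc by (intro G.finprod_int_pow) auto
        also have "\<dots> = finprod G (\<lambda>t. t [^]\<^bsub>G\<^esub> (c s t * d s)) T"
          using Tc by (intro G.finprod_cong') (auto simp: G.int_pow_pow)
        finally show "k s [^]\<^bsub>G\<^esub> d s = s [^]\<^bsub>G\<^esub> (n s * d s) \<otimes>\<^bsub>G\<^esub> finprod G (\<lambda>t. t [^]\<^bsub>G\<^esub> (c s t * d s)) T"
          using s S by (auto simp: G.int_pow_pow)
      qed (use S Tc in \<open>auto intro!: G.finprod_closed G.m_closed\<close>)
      also have "\<dots> = finprod G (\<lambda>s. s [^]\<^bsub>G\<^esub> (n s * d s)) (S - T) \<otimes>\<^bsub>G\<^esub>
          finprod G (\<lambda>s. finprod G (\<lambda>t. t [^]\<^bsub>G\<^esub> (c s t * d s)) T) (S - T)"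
        using S Tc by (intro G.finprod_multf) (auto intro!: G.finprod_closed)
      also have "finprod G (\<lambda>s. finprod G (\<lambda>t. t [^]\<^bsub>G\<^esub> (c s t * d s)) T) (S - T)
          = finprod G (\<lambda>t. finprod G (\<lambda>s. t [^]\<^bsub>G\<^esub> (c s t * d s)) (S - T)) T"
        using Tc finT \<open>finite S\<close> by (intro G.finprod_swap) auto
      also have "\<dots> = finprod G (\<lambda>t. t [^]\<^bsub>G\<^esub> e t) T"
        using Tc \<open>finite S\<close> by (intro G.finprod_cong') (auto simp: e_def G.finprod_int_pow_sum)
      also have "finprod G (\<lambda>s. s [^]\<^bsub>G\<^esub> (n s * d s)) (S - T) = finprod G (\<lambda>s. s [^]\<^bsub>G\<^esub> e s) (S - T)"
        using S by (intro G.finprod_cong') (auto simp: e_def)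
      also have "finprod G (\<lambda>s. s [^]\<^bsub>G\<^esub> e s) (S - T) \<otimes>\<^bsub>G\<^esub> finprod G (\<lambda>s. s [^]\<^bsub>G\<^esub> e s) T
          = finprod G (\<lambda>s. s [^]\<^bsub>G\<^esub> e s) ((S - T) \<union> T)"
        using S Tc finT \<open>finite S\<close> by (intro G.finprod_Un_disjoint[symmetric]) auto
      also have "(S - T) \<union> T = S" using TS by auto
      finally have "\<forall>x\<in>S. e x = 0"
        using S(1) d unfolding int_independent_def by metis
      then show ?thesis
        using n by (auto simp: e_def split: if_splits)
    qed
    have "int_independent G (k ` (S - T)) \<and> card (k ` (S - T)) = card (S - T)"
      using \<open>finite S\<close> kc indk by (intro G.int_independent_image) auto
    then have 1: "enat (card (S - T)) \<le> sub_rank G (kernel G H h)"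
      using card_le_sub_rank[of G "k ` (S - T)" "kernel G H h"] ker by auto
    have "int_independent H (h ` T) \<and> card (h ` T) = card T"
      using T Tc finT by (intro H.int_independent_image) (auto simp: P_def Q_def)
    then have 2: "enat (card T) \<le> sub_rank H (h ` carrier G)"
      using card_le_sub_rank[of H "h ` T" "h ` carrier G"] Tc by (metis image_mono)
    have "enat (card S) = enat (card (S - T)) + enat (card T)"
      using TS \<open>finite S\<close> by (simp add: card_Diff_subset finT card_mono)
    then show "enat (card S) \<le> sub_rank G (kernel G H h) + sub_rank H (h ` carrier G)"
      using add_mono[OF 1 2] by simp
  qed
  show "sub_rank G (kernel G H h) + sub_rank H (h ` carrier G) \<le> abelian_rank G"
    unfolding sub_rank_def
  proof (rule enat_Sup_add_le)
    fix a b
    assume "a \<in> (\<lambda>S. enat (card S)) ` {S. int_independent G S \<and> S \<subseteq> kernel G H h}"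
      and "b \<in> (\<lambda>S. enat (card S)) ` {S. int_independent H S \<and> S \<subseteq> h ` carrier G}"
    then obtain S T where a: "a = enat (card S)" and S: "int_independent G S" "S \<subseteq> kernel G H h"
      and b: "b = enat (card T)" and T: "int_independent H T" "T \<subseteq> h ` carrier G"
      by auto
    have fin: "finite S" "finite T"
      using S T by (auto simp: int_independent_def)
    define g where "g = inv_into (carrier G) h"
    have g: "\<And>t. t \<in> T \<Longrightarrow> g t \<in> carrier G" "\<And>t. t \<in> T \<Longrightarrow> h (g t) = t"
      using T(2) by (auto simp: g_def intro!: inv_into_into f_inv_into_f dest: subsetD)
    have Sc: "S \<subseteq> carrier G" and hS: "\<And>s. s \<in> S \<Longrightarrow> h s = \<one>\<^bsub>H\<^esub>"
      using S(2) by (auto simp: kernel_def)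
    have Tc: "T \<subseteq> carrier H"
      using T(2) by auto
    \<comment> \<open>The tagged union keeps kernel elements and lifts apart before they are known
      to be distinct in \<open>G\<close>. Applying \<open>h\<close> to a relation removes the kernel
      part and leaves a relation on \<open>T\<close>.\<close>
    define I where "I = Inl ` S \<union> Inr ` T"
    define u where "u = case_sum (\<lambda>s. s) g"
    have finI: "finite I" and uc: "u \<in> I \<rightarrow> carrier G"
      using fin Sc g by (auto simp: I_def u_def)
    have split: "finprod G (\<lambda>i. u i [^]\<^bsub>G\<^esub> c i) I
        = finprod G (\<lambda>s. s [^]\<^bsub>G\<^esub> c (Inl s)) S \<otimes>\<^bsub>G\<^esub> finprod G (\<lambda>t. g t [^]\<^bsub>G\<^esub> c (Inr t)) T" for c :: "'a + 'c \<Rightarrow> int"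
    proof -
      have "finprod G (\<lambda>i. u i [^]\<^bsub>G\<^esub> c i) I
          = finprod G (\<lambda>i. u i [^]\<^bsub>G\<^esub> c i) (Inl ` S) \<otimes>\<^bsub>G\<^esub> finprod G (\<lambda>i. u i [^]\<^bsub>G\<^esub> c i) (Inr ` T)"
        unfolding I_def using fin uc by (intro G.finprod_Un_disjoint) (auto simp: I_def)
      also have "finprod G (\<lambda>i. u i [^]\<^bsub>G\<^esub> c i) (Inl ` S) = finprod G (\<lambda>s. s [^]\<^bsub>G\<^esub> c (Inl s)) S"
        using uc by (subst G.finprod_reindex) (auto simp: I_def u_def)
      also have "finprod G (\<lambda>i. u i [^]\<^bsub>G\<^esub> c i) (Inr ` T) = finprod G (\<lambda>t. g t [^]\<^bsub>G\<^esub> c (Inr t)) T"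
        using uc by (subst G.finprod_reindex) (auto simp: I_def u_def)
      finally show ?thesis .
    qed
    have "\<forall>i\<in>I. c i = 0" if c: "finprod G (\<lambda>i. u i [^]\<^bsub>G\<^esub> (c i :: int)) I = \<one>\<^bsub>G\<^esub>" for c
    proof -
      have "\<one>\<^bsub>H\<^esub> = h (finprod G (\<lambda>i. u i [^]\<^bsub>G\<^esub> c i) I)"
        by (simp add: c)
      also have "\<dots> = h (finprod G (\<lambda>s. s [^]\<^bsub>G\<^esub> c (Inl s)) S) \<otimes>\<^bsub>H\<^esub> h (finprod G (\<lambda>t. g t [^]\<^bsub>G\<^esub> c (Inr t)) T)"
        unfolding split using Sc g by (intro hom_mult) (auto intro!: G.finprod_closed)
      also have "h (finprod G (\<lambda>s. s [^]\<^bsub>G\<^esub> c (Inl s)) S) = finprod H (\<lambda>s. h (s [^]\<^bsub>G\<^esub> c (Inl s))) S"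
        using Sc fin by (intro hom_finprod[OF G H h]) auto
      also have "\<dots> = \<one>\<^bsub>H\<^esub>"
        using Sc hS by (intro H.finprod_one_eqI) (auto simp: hom_int_pow subset_iff)
      also have "h (finprod G (\<lambda>t. g t [^]\<^bsub>G\<^esub> c (Inr t)) T) = finprod H (\<lambda>t. h (g t [^]\<^bsub>G\<^esub> c (Inr t))) T"
        using g fin by (intro hom_finprod[OF G H h]) auto
      also have "\<dots> = finprod H (\<lambda>t. t [^]\<^bsub>H\<^esub> c (Inr t)) T"
        using g Tc by (intro H.finprod_cong') (auto simp: hom_int_pow)
      finally have "finprod H (\<lambda>t. t [^]\<^bsub>H\<^esub> c (Inr t)) T = \<one>\<^bsub>H\<^esub>"
        using Tc by (simp add: H.finprod_closed Pi_iff subset_iff)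
      then have T0: "\<forall>t\<in>T. c (Inr t) = 0"
        using spec[OF conjunct2[OF conjunct2[OF T(1)[unfolded int_independent_def]]], of "\<lambda>t. c (Inr t)"] by blast
      then have "finprod G (\<lambda>t. g t [^]\<^bsub>G\<^esub> c (Inr t)) T = \<one>\<^bsub>G\<^esub>"
        by (intro G.finprod_one_eqI) auto
      then have "finprod G (\<lambda>s. s [^]\<^bsub>G\<^esub> c (Inl s)) S = \<one>\<^bsub>G\<^esub>"
        using split[of c] c Sc by (simp add: G.finprod_closed Pi_iff subset_iff)
      then have "\<forall>s\<in>S. c (Inl s) = 0"
        using spec[OF conjunct2[OF conjunct2[OF S(1)[unfolded int_independent_def]]], of "\<lambda>t. c (Inl t)"] by blast
      then show ?thesis using T0 by (auto simp: I_def)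
    qed
    then have "int_independent G (u ` I) \<and> card (u ` I) = card I"
      using finI uc by (intro G.int_independent_image) auto
    moreover have "card I = card S + card T"
      unfolding I_def using fin by (subst card_Un_disjoint) (auto simp: card_image)
    ultimately show "a + b \<le> abelian_rank G"
      using card_le_sub_rank[of G "u ` I" "carrier G"] uc
      by (auto simp: a b abelian_rank_eq_sub_rank)
  qed (blast intro: int_independent_empty)+
qed

lemma abelian_rank_iso:
  assumes "comm_group G" "comm_group H" "G \<cong> H"
  shows "abelian_rank G = abelian_rank H"
proof -
  obtain h where h: "h \<in> iso G H"
    using assms(3) by (auto simp: is_iso_def)
  interpret G: comm_group G by fact
  interpret H: comm_group H by fact
  interpret group_hom G H h
    using h by unfold_locales (simp add: iso_def)
  have "kernel G H h = {\<one>\<^bsub>G\<^esub>}"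
    using h inj_iff_trivial_ker by (simp add: iso_def bij_betw_def)
  moreover have "h ` carrier G = carrier H"
    using h by (simp add: iso_def bij_betw_def)
  ultimately show ?thesis
    using abelian_rank_hom[OF assms(1,2) homh] G.sub_rank_one
    by (simp add: abelian_rank_eq_sub_rank)
qed

lemma abelian_rank_trivial:
  assumes "comm_group G" "trivial_group G"
  shows "abelian_rank G = 0"
  using assms comm_group.sub_rank_one[OF assms(1)] by (simp add: abelian_rank_eq_sub_rank trivial_group_def)

lemma abelian_rank_integer_group: "abelian_rank integer_group = 1"
proof (rule antisym)
  interpret comm_group integer_group
    by (rule abelian_integer_group)
  have prod: "finprod integer_group f S = sum f S" if "finite S" for f :: "int \<Rightarrow> int" and S
    using that by (induction S rule: finite_induct) auto
  show "abelian_rank integer_group \<le> 1"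
    unfolding abelian_rank_eq_sub_rank
  proof (rule sub_rank_le)
    fix S assume S: "int_independent integer_group S"
    then have fin: "finite S" by (simp add: int_independent_def)
    have "x = y" if xy: "x \<in> S" "y \<in> S" for x y
    proof (rule ccontr)
      assume ne: "x \<noteq> y"
      \<comment> \<open>This encodes \<open>y * x - x * y = 0\<close>. If both coefficients vanish,
        then \<open>x\<close> and \<open>y\<close> are both 0, contradicting
        \<open>x \<noteq> y\<close>.\<close>
      let ?c = "\<lambda>z. (if z = x then y else 0) + (if z = y then - x else 0)"
      have "finprod integer_group (\<lambda>z. z [^]\<^bsub>integer_group\<^esub> ?c z) S = (\<Sum>z\<in>S. ?c z * z)"
        using fin by (simp add: prod group_int_pow_integer_group mult.commute)
      also have "\<dots> = (\<Sum>z\<in>S. if z = x then y * x else 0) + (\<Sum>z\<in>S. if z = y then - x * y else 0)"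
        unfolding sum.distrib[symmetric] by (rule sum.cong) auto
      also have "\<dots> = \<one>\<^bsub>integer_group\<^esub>"
        using fin xy by simp
      finally have "\<forall>z\<in>S. ?c z = 0"
        using spec[OF conjunct2[OF conjunct2[OF S[unfolded int_independent_def]]], of ?c] by blast
      then have "?c x = 0" "?c y = 0" using xy by blast+
      then show False using ne by simp
    qed
    then have "card S \<le> 1"
      using fin by (metis card_le_Suc0_iff_eq One_nat_def)
    then show "enat (card S) \<le> 1"
      by (simp add: one_enat_def)
  qed
  have "int_independent integer_group {1::int}"
    by (auto simp: int_independent_def prod group_int_pow_integer_group)
  from card_le_sub_rank[OF this, of UNIV] show "1 \<le> abelian_rank integer_group"
    by (simp add: abelian_rank_eq_sub_rank one_enat_def)
qed

section \<open>Additivity of the Euler characteristic\<close>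

text \<open>Stated for sequences instead of spaces, so that ranks of images in an exact sequence can
  be summed in the same way as Betti numbers.\<close>

definition finitely_supported :: "(nat \<Rightarrow> enat) \<Rightarrow> bool" where
  "finitely_supported b \<longleftrightarrow> (\<forall>p. b p \<noteq> \<infinity>) \<and> finite {p. b p \<noteq> 0}"

definition alternating_sum :: "(nat \<Rightarrow> enat) \<Rightarrow> int" where
  "alternating_sum b = (\<Sum>p | b p \<noteq> 0. (-1) ^ p * int (the_enat (b p)))"

lemma euler_characteristic_alternating_sum:
  "euler_characteristic_defined X \<longleftrightarrow> finitely_supported (\<lambda>p. betti_number p X)"
  "euler_characteristic X = alternating_sum (\<lambda>p. betti_number p X)"
  by (simp_all add: euler_characteristic_defined_def finitely_supported_def
      euler_characteristic_def alternating_sum_def)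

lemma alternating_sum_superset:
  assumes "finite P" "{p. b p \<noteq> 0} \<subseteq> P"
  shows "alternating_sum b = (\<Sum>p\<in>P. (-1) ^ p * int (the_enat (b p)))"
  unfolding alternating_sum_def
  using assms by (intro sum.mono_neutral_left) (auto simp: zero_enat_def)

lemma finitely_supported_le:
  assumes "finitely_supported b" "\<And>p. a p \<le> b p"
  shows "finitely_supported a"
proof -
  have "a p \<noteq> \<infinity>" for p
    using assms by (metis finitely_supported_def enat_ord_simps(5))
  moreover have "{p. a p \<noteq> 0} \<subseteq> {p. b p \<noteq> 0}"
    using assms(2) by (auto simp: ) (metis ile0_eq)
  ultimately show ?thesis
    using assms(1) finite_subset by (auto simp: finitely_supported_def)
qed

lemma finitely_supported_add:
  assumes "finitely_supported a" "finitely_supported b"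
  shows "finitely_supported (\<lambda>p. a p + b p)"
proof -
  have "{p. a p + b p \<noteq> 0} \<subseteq> {p. a p \<noteq> 0} \<union> {p. b p \<noteq> 0}"
    by auto
  then show ?thesis
    using assms finite_subset by (fastforce simp: finitely_supported_def plus_eq_infty_iff_enat)
qed

lemma alternating_sum_add:
  assumes "finitely_supported a" "finitely_supported b"
  shows "alternating_sum (\<lambda>p. a p + b p) = alternating_sum a + alternating_sum b"
proof -
  define P where "P = {p. a p \<noteq> 0} \<union> {p. b p \<noteq> 0}"
  have P: "finite P" "{p. a p \<noteq> 0} \<subseteq> P" "{p. b p \<noteq> 0} \<subseteq> P" "{p. a p + b p \<noteq> 0} \<subseteq> P"
    using assms by (auto simp: P_def finitely_supported_def)
  have "the_enat (a p + b p) = the_enat (a p) + the_enat (b p)" for p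
  proof -
    have "a p \<noteq> \<infinity>" "b p \<noteq> \<infinity>"
      using assms by (simp_all add: finitely_supported_def)
    then show ?thesis by (cases "a p"; cases "b p") auto
  qed
  then show ?thesis
    by (simp add: alternating_sum_superset[OF P(1,2)] alternating_sum_superset[OF P(1,3)]
        alternating_sum_superset[OF P(1,4)] sum.distrib[symmetric] algebra_simps)
qed

lemma finitely_supported_shift:
  assumes "d 0 = 0"
  shows "finitely_supported (\<lambda>p. d (Suc p)) \<longleftrightarrow> finitely_supported d"
proof -
  have "{p. d p \<noteq> 0} = Suc ` {p. d (Suc p) \<noteq> 0}"
    using assms by (auto simp: image_iff) (metis not0_implies_Suc)
  moreover have "(\<forall>p. d p \<noteq> \<infinity>) \<longleftrightarrow> (\<forall>p. d (Suc p) \<noteq> \<infinity>)"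
    using assms by (metis not0_implies_Suc i0_ne_infinity)
  ultimately show ?thesis
    by (simp add: finitely_supported_def finite_image_iff)
qed

lemma alternating_sum_shift:
  assumes "d 0 = 0"
  shows "alternating_sum (\<lambda>p. d (Suc p)) = - alternating_sum d"
proof -
  have "{p. d p \<noteq> 0} = Suc ` {p. d (Suc p) \<noteq> 0}"
    using assms by (auto simp: image_iff) (metis not0_implies_Suc)
  then show ?thesis
    by (simp add: alternating_sum_def sum.reindex sum_negf)
qed

text \<open>\<open>i\<close>, \<open>j\<close> and \<open>d\<close> stand for the ranks of the
  images of the inclusion, of the map to the relative groups and of the boundary map; each equation
  is rank-nullity at one place of the long exact sequence. The boundary lowers the degree, so its
  two contributions have opposite signs and cancel.\<close>

lemma long_exact_alternating_sum:
  assumes a: "\<And>p. a p = d (Suc p) + i p" and x: "\<And>p. x p = i p + j p"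
    and r: "\<And>p. r p = j p + d p" and d0: "d 0 = 0"
  shows "finitely_supported a \<Longrightarrow> finitely_supported x \<Longrightarrow> finitely_supported r"
    and "finitely_supported a \<Longrightarrow> finitely_supported r \<Longrightarrow> finitely_supported x"
    and "finitely_supported a \<Longrightarrow> finitely_supported x \<Longrightarrow>
           alternating_sum x = alternating_sum a + alternating_sum r"
proof -
  have a': "a = (\<lambda>p. d (Suc p) + i p)" and x': "x = (\<lambda>p. i p + j p)" and r': "r = (\<lambda>p. j p + d p)"
    using a x r by auto
  have di: "finitely_supported d" "finitely_supported i" if "finitely_supported a"
    using that finitely_supported_le[of a "\<lambda>p. d (Suc p)"] finitely_supported_le[of a i]
    by (auto simp: a finitely_supported_shift[of d, OF d0])
  have xj: "finitely_supported j" if "finitely_supported x"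
    using that by (rule finitely_supported_le) (simp add: x)
  have rj: "finitely_supported j" if "finitely_supported r"
    using that by (rule finitely_supported_le) (simp add: r)
  show "finitely_supported r" if "finitely_supported a" "finitely_supported x"
    unfolding r' using di xj that by (intro finitely_supported_add)
  show "finitely_supported x" if "finitely_supported a" "finitely_supported r"
    unfolding x' using di rj that by (intro finitely_supported_add)
  show "alternating_sum x = alternating_sum a + alternating_sum r" if "finitely_supported a" "finitely_supported x"
    unfolding a' x' r' using di xj that d0
    by (simp add: alternating_sum_add alternating_sum_shift finitely_supported_shift)
qed

section \<open>The long exact sequence of a pair and Mayer-Vietoris\<close>

definition relative_betti :: "'a topology \<Rightarrow> 'a set \<Rightarrow> nat \<Rightarrow> enat" where
  "relative_betti X S p = abelian_rank (relative_homology_group (int p) X S)"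

lemma relative_betti_empty: "relative_betti X {} = (\<lambda>p. betti_number p X)"
  by (simp add: relative_betti_def betti_number_def fun_eq_iff)

text \<open>Rank-nullity is applied to \<open>I\<close>, \<open>J\<close> and \<open>D\<close>, and
  exactness replaces each kernel by the image of the preceding map.\<close>

lemma relative_betti_exact:
  fixes X :: "'a topology" and S :: "'a set"
  defines "a \<equiv> relative_betti (subtopology X S) {}" and "x \<equiv> relative_betti X {}" and "r \<equiv> relative_betti X S"
  shows "finitely_supported a \<Longrightarrow> finitely_supported x \<Longrightarrow> finitely_supported r"
    and "finitely_supported a \<Longrightarrow> finitely_supported r \<Longrightarrow> finitely_supported x"
    and "finitely_supported a \<Longrightarrow> finitely_supported x \<Longrightarrow>
           alternating_sum x = alternating_sum a + alternating_sum r"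
proof -
  define Y where "Y = subtopology X S"
  define HA where "HA p = homology_group p Y" for p
  define HX where "HX p = homology_group p X" for p
  define HR where "HR p = relative_homology_group p X S" for p
  define I where "I p = hom_induced p Y {} X {} id" for p
  define J where "J p = hom_induced p X {} X S id" for p
  define D where "D p = hom_boundary p X S" for p
  define i where "i p = sub_rank (HX (int p)) (I (int p) ` carrier (HA (int p)))" for p
  define j where "j p = sub_rank (HR (int p)) (J (int p) ` carrier (HX (int p)))" for p
  define d where "d p = sub_rank (HA (int p - 1)) (D (int p) ` carrier (HR (int p)))" for p
  have comm: "comm_group (HA p)" "comm_group (HX p)" "comm_group (HR p)" for p
    by (simp_all add: HA_def HX_def HR_def)
  have hom: "I p \<in> hom (HA p) (HX p)" "J p \<in> hom (HX p) (HR p)" "D p \<in> hom (HR p) (HA (p - 1))" for p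
    by (simp_all add: HA_def HX_def HR_def I_def J_def D_def Y_def hom_induced_hom hom_boundary_hom)
  have exR: "kernel (HR p) (HA (p - 1)) (D p) = J p ` carrier (HX p)" for p
    using homology_exactness_axiom_1[of p X S]
    by (simp add: HA_def HX_def HR_def I_def J_def D_def Y_def)
  have exA: "kernel (HA (p - 1)) (HX (p - 1)) (I (p - 1)) = D p ` carrier (HR p)" for p
    using homology_exactness_axiom_2[of p X S]
    by (simp add: HA_def HX_def HR_def I_def J_def D_def Y_def)
  have exX: "kernel (HX p) (HR p) (J p) = I p ` carrier (HA p)" for p
    using homology_exactness_axiom_3[of p X S]
    by (simp add: HA_def HX_def HR_def I_def J_def D_def Y_def)
  have A: "a p = d (Suc p) + i p" for p
    using abelian_rank_hom[OF comm(1,2) hom(1), of "int p"] exA[of "int (Suc p)"]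
    by (simp add: a_def relative_betti_def d_def i_def HA_def Y_def)
  have X: "x p = i p + j p" for p
    using abelian_rank_hom[OF comm(2,3) hom(2), of "int p"] exX[of "int p"]
    by (simp add: x_def relative_betti_def j_def i_def HX_def)
  have R: "r p = j p + d p" for p
    using abelian_rank_hom[OF comm(3,1) hom(3), of "int p"] exR[of "int p"]
    by (simp add: r_def relative_betti_def j_def d_def HR_def)
  \<comment> \<open>The boundary map out of degree 0 lands in degree -1, where homology is
    trivial.\<close>
  have d0: "d 0 = 0"
  proof -
    have "trivial_group (HA (- 1))"
      by (simp add: HA_def)
    then have "carrier (HA (- 1)) = {\<one>\<^bsub>HA (- 1)\<^esub>}"
      by (simp add: trivial_group_def)
    moreover have "D 0 ` carrier (HR 0) \<subseteq> carrier (HA (- 1))"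
      using hom(3)[of 0] by (auto simp: hom_def)
    ultimately have sub: "D 0 ` carrier (HR 0) \<subseteq> {\<one>\<^bsub>HA (- 1)\<^esub>}"
      by (simp only:)
    have "d 0 \<le> sub_rank (HA (- 1)) {\<one>\<^bsub>HA (- 1)\<^esub>}"
      unfolding d_def using order_trans[OF _ sub] by (intro sub_rank_le) (simp add: card_le_sub_rank)
    then show ?thesis
      using comm_group.sub_rank_one[OF comm(1)] by simp
  qed
  note * = long_exact_alternating_sum[of a d i x j r, OF A X R d0]
  show "finitely_supported a \<Longrightarrow> finitely_supported x \<Longrightarrow> finitely_supported r"
    and "finitely_supported a \<Longrightarrow> finitely_supported r \<Longrightarrow> finitely_supported x"
    and "finitely_supported a \<Longrightarrow> finitely_supported x \<Longrightarrow>
           alternating_sum x = alternating_sum a + alternating_sum r"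
    by (fact *)+
qed

text \<open>Excising the complement of \<open>V\<close> identifies the relative homology of
  \<open>(V, U \<inter> V)\<close> with that of \<open>(X, U)\<close>. Additivity for both pairs,
  with the common relative term eliminated, gives the formula.\<close>

lemma euler_characteristic_mayer_vietoris_cover:
  assumes "openin X U" "openin X V" "U \<union> V = topspace X"
    and U: "euler_characteristic_defined (subtopology X U)"
    and V: "euler_characteristic_defined (subtopology X V)"
    and UV: "euler_characteristic_defined (subtopology X (U \<inter> V))"
  shows "euler_characteristic_defined X \<and> euler_characteristic X =
     euler_characteristic (subtopology X U) + euler_characteristic (subtopology X V)
     - euler_characteristic (subtopology X (U \<inter> V))"
proof -
  \<comment> \<open>The complement of \<open>V\<close> is already closed, and it lies in the open
    set \<open>U\<close> because \<open>U\<close> and \<open>V\<close> cover.\<close>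
  have "X closure_of (topspace X - V) \<subseteq> X interior_of U"
    using assms(1-3) by (auto simp: closure_of_closedin closedin_diff interior_of_openin)
  note excision = homology_excision_axiom[OF this openin_subset[OF assms(1)]]
  have "topspace X - (topspace X - V) = V" "U - (topspace X - V) = U \<inter> V"
    using openin_subset[OF assms(1)] openin_subset[OF assms(2)] by auto
  then have iso: "relative_homology_group p (subtopology X V) (U \<inter> V) \<cong> relative_homology_group p X U" for p
    using excision[of p] by (auto simp: is_iso_def)
  have eq: "relative_betti (subtopology X V) (U \<inter> V) = relative_betti X U"
    unfolding relative_betti_def using iso by (auto intro!: abelian_rank_iso)
  have sub: "subtopology (subtopology X V) (U \<inter> V) = subtopology X (U \<inter> V)"
    by (simp add: subtopology_subtopology Int_commute inf.left_commute)
  note v = relative_betti_exact[of "subtopology X V" "U \<inter> V", unfolded sub eq relative_betti_empty,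
      folded euler_characteristic_alternating_sum]
  note x = relative_betti_exact[of X U, unfolded relative_betti_empty, folded euler_characteristic_alternating_sum]
  show ?thesis
  proof -
    have X: "euler_characteristic_defined X"
      by (rule x(2)[OF U v(1)[OF UV V]])
    with v(3)[OF UV V] x(3)[OF U X] show ?thesis
      by simp
  qed
qed

lemma euler_characteristic_mayer_vietoris:
  assumes "openin X U" "openin X V"
    and "euler_characteristic_defined (subtopology X U)"
    and "euler_characteristic_defined (subtopology X V)"
    and "euler_characteristic_defined (subtopology X (U \<inter> V))"
  shows "euler_characteristic_defined (subtopology X (U \<union> V)) \<and>
     euler_characteristic (subtopology X (U \<union> V)) =
     euler_characteristic (subtopology X U) + euler_characteristic (subtopology X V)
     - euler_characteristic (subtopology X (U \<inter> V))"
proof -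
  have sub: "U \<subseteq> topspace X" "V \<subseteq> topspace X"
    using assms openin_subset by auto
  have *: "(U \<union> V) \<inter> U = U" "(U \<union> V) \<inter> V = V" "(U \<union> V) \<inter> (U \<inter> V) = U \<inter> V"
    by auto
  show ?thesis
    using euler_characteristic_mayer_vietoris_cover[of "subtopology X (U \<union> V)" U V] assms sub
      Int_absorb1[of "U \<union> V" "topspace X"]
    by (simp add: subtopology_subtopology * openin_open_subtopology openin_Un topspace_subtopology_subset)
qed

section \<open>Euler characteristics of empty, contractible and disjoint pieces\<close>

lemma euler_characteristic_empty:
  assumes "topspace X = {}"
  shows "euler_characteristic_defined X \<and> euler_characteristic X = 0"
proof -
  have "betti_number p X = 0" for p
    unfolding betti_number_def using assms
    by (intro abelian_rank_trivial) (simp_all add: trivial_homology_group_empty)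
  then show ?thesis
    by (simp add: euler_characteristic_defined_def euler_characteristic_def)
qed

lemma euler_characteristic_contractible:
  assumes "contractible_space X" "topspace X \<noteq> {}"
  shows "euler_characteristic_defined X \<and> euler_characteristic X = 1"
proof -
  obtain a where a: "a \<in> topspace X" and "X homotopy_equivalent_space subtopology X {a}"
    using assms by (auto simp: contractible_eq_homotopy_equivalent_singleton_subtopology)
  from this(2) have iso: "homology_group p X \<cong> homology_group p (subtopology X {a})" for p
    by (rule homotopy_equivalent_space_imp_isomorphic_homology_groups)
  have "trivial_group (homology_group p (subtopology X {a}))" if "p \<noteq> 0" for p
    using that a by (intro homology_dimension_axiom) auto
  then have "betti_number p X = 0" if "p \<noteq> 0" for p
    using that abelian_rank_iso[OF _ _ iso[of "int p"]] by (simp add: betti_number_def abelian_rank_trivial)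
  moreover have "betti_number 0 X = 1"
    using abelian_rank_iso[OF _ _ isomorphic_integer_zeroth_homology_group, of X] assms
    by (simp add: betti_number_def abelian_rank_integer_group abelian_integer_group
        contractible_imp_path_connected_space)
  ultimately have b: "betti_number p X = (if p = 0 then 1 else 0)" for p
    by auto
  then have "{p. betti_number p X \<noteq> 0} = {0}"
    by auto
  then show ?thesis
    by (simp add: euler_characteristic_defined_def euler_characteristic_def b one_enat_def zero_enat_def)
qed

text \<open>By induction, the new set is disjoint from the open union of the others, so
  Mayer-Vietoris has an empty correction term and each set contributes 1.\<close>

lemma euler_characteristic_disjoint_contractible:
  assumes "finite I" and "\<And>i. i \<in> I \<Longrightarrow> openin X (W i)" and "disjoint_family_on W I"
    and "\<And>i. i \<in> I \<Longrightarrow> contractible_space (subtopology X (W i))" and "\<And>i. i \<in> I \<Longrightarrow> W i \<noteq> {}"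
  shows "euler_characteristic_defined (subtopology X (\<Union>i\<in>I. W i)) \<and>
    euler_characteristic (subtopology X (\<Union>i\<in>I. W i)) = int (card I)"
  using assms
proof (induction I rule: finite_induct)
  case empty
  then show ?case
    using euler_characteristic_empty[of "subtopology X {}"] by simp
next
  case (insert i I)
  have IH: "euler_characteristic_defined (subtopology X (\<Union>i\<in>I. W i)) \<and>
    euler_characteristic (subtopology X (\<Union>i\<in>I. W i)) = int (card I)"
    using insert by (intro insert.IH) (auto simp: disjoint_family_on_def)
  have disj: "W i \<inter> (\<Union>i\<in>I. W i) = {}"
    using insert by (auto simp: disjoint_family_on_def)
  have "topspace (subtopology X (W i)) \<noteq> {}"
    using insert.prems(1,4)[of i] openin_subset[of X "W i"] by (auto simp: topspace_subtopology_subset)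
  then have 1: "euler_characteristic_defined (subtopology X (W i)) \<and> euler_characteristic (subtopology X (W i)) = 1"
    using insert.prems by (intro euler_characteristic_contractible) auto
  have 0: "euler_characteristic_defined (subtopology X {}) \<and> euler_characteristic (subtopology X {}) = 0"
    by (rule euler_characteristic_empty) simp
  have "openin X (W i)" "openin X (\<Union>i\<in>I. W i)"
    using insert.prems by auto
  from euler_characteristic_mayer_vietoris[OF this, unfolded disj] show ?case
    using IH 1 0 insert.hyps by simp
qed

section \<open>The topology of theta graphs\<close>

fun height :: "'a suspension_point \<Rightarrow> real" where
  "height South = 0"
| "height North = 1"
| "height (Between e t) = t"

text \<open>The value at the poles is irrelevant.\<close>

fun edge :: "nat suspension_point \<Rightarrow> nat" where
  "edge (Between e t) = e"
| "edge p = 0"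

text \<open>Passing through \<open>suspension_proj\<close> lets a point of an edge arrive at a pole
  when the new height is 0 or 1.\<close>

fun set_height :: "'a suspension_point \<Rightarrow> real \<Rightarrow> 'a suspension_point" where
  "set_height (Between e t) s = suspension_proj (e, s)"
| "set_height p s = p"

definition interior_point :: "'a suspension_point \<Rightarrow> bool" where
  "interior_point p \<longleftrightarrow> 0 < height p \<and> height p < 1"

lemma quotient_map_theta_graph:
  "quotient_map (prod_topology (discrete_topology {..<m}) (top_of_set {0..1})) (theta_graph m) suspension_proj"
  unfolding theta_graph_def suspension_def by (rule quotient_map_quotient_topology)

lemma topspace_theta_graph: "topspace (theta_graph m) = suspension_proj ` ({..<m} \<times> {0..1})"
  unfolding theta_graph_def suspension_def by (simp add: topspace_quotient_topology)

lemma theta_graph_cases: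
  assumes "p \<in> topspace (theta_graph m)"
  obtains "p = South" | "p = North" | e t where "p = Between e t" "e < m" "0 < t" "t < 1"
  using assms by (auto simp: topspace_theta_graph split: if_splits)

lemma Between_in_theta_graph: "Between e t \<in> topspace (theta_graph m) \<longleftrightarrow> e < m \<and> 0 < t \<and> t < 1"
proof
  assume "e < m \<and> 0 < t \<and> t < 1"
  then have "(e, t) \<in> {..<m} \<times> {0..1}" "Between e t = suspension_proj (e, t)"
    by auto
  then show "Between e t \<in> topspace (theta_graph m)"
    unfolding topspace_theta_graph by (rule image_eqI[rotated])
qed (auto elim: theta_graph_cases)

lemma poles_in_theta_graph:
  assumes "m \<ge> 1"
  shows "South \<in> topspace (theta_graph m)" "North \<in> topspace (theta_graph m)"
proof -
  have "South = suspension_proj (0::nat, 0)" "North = suspension_proj (0::nat, 1)"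
    by auto
  then show "South \<in> topspace (theta_graph m)" "North \<in> topspace (theta_graph m)"
    using assms unfolding topspace_theta_graph by (auto intro!: imageI simp del: suspension_proj.simps)
qed

lemma height_bounds:
  assumes "p \<in> topspace (theta_graph m)"
  shows "0 \<le> height p" "height p \<le> 1"
  using assms by (auto elim!: theta_graph_cases)

lemma interior_point_theta_graph:
  assumes "p \<in> topspace (theta_graph m)"
  shows "interior_point p \<longleftrightarrow> p \<noteq> South \<and> p \<noteq> North"
  using assms by (auto elim!: theta_graph_cases simp: interior_point_def)

lemma edge_less:
  assumes "p \<in> topspace (theta_graph m)" "interior_point p"
  shows "edge p < m"
  using assms by (auto elim!: theta_graph_cases simp: interior_point_def)

lemma continuous_map_suspension_proj:
  assumes "e < m"
  shows "continuous_map (top_of_set {0..1}) (theta_graph m) (\<lambda>t. suspension_proj (e, t))"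
proof -
  have "continuous_map (top_of_set {0..1}) (prod_topology (discrete_topology {..<m}) (top_of_set {0..1::real})) (\<lambda>t. (e, t))"
    using assms by (intro continuous_map_pairedI) auto
  from continuous_map_compose[OF this quotient_imp_continuous_map[OF quotient_map_theta_graph]]
  show ?thesis by (simp add: o_def del: suspension_proj.simps)
qed

lemma continuous_map_height: "continuous_map (theta_graph m) euclideanreal height"
proof (rule continuous_compose_quotient_map[OF quotient_map_theta_graph])
  have "continuous_map (prod_topology (discrete_topology {..<m}) (top_of_set {0..1})) euclideanreal snd"
    using continuous_map_snd continuous_map_in_subtopology by blast
  then show "continuous_map (prod_topology (discrete_topology {..<m}) (top_of_set {0..1})) euclideanreal
      (height \<circ> suspension_proj)"
    by (rule continuous_map_eq) auto
qed

lemma openin_theta_graph: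
  assumes "U \<subseteq> topspace (theta_graph m)"
  shows "openin (theta_graph m) U \<longleftrightarrow>
    openin (prod_topology (discrete_topology {..<m}) (top_of_set {0..1}))
      {x \<in> topspace (prod_topology (discrete_topology {..<m}) (top_of_set {0..1})). suspension_proj x \<in> U}"
  using conjunct2[OF quotient_map_theta_graph[of m, unfolded quotient_map_def], rule_format, OF assms] by (rule sym)

lemma closedin_theta_graph:
  assumes "U \<subseteq> topspace (theta_graph m)"
  shows "closedin (theta_graph m) U \<longleftrightarrow>
    closedin (prod_topology (discrete_topology {..<m}) (top_of_set {0..1}))
      {x \<in> topspace (prod_topology (discrete_topology {..<m}) (top_of_set {0..1})). suspension_proj x \<in> U}"
  using conjunct2[OF quotient_map_theta_graph[of m, unfolded quotient_map_closedin], rule_format, OF assms] by (rule sym)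

text \<open>The preimage in the product is an open edge, or empty if \<open>e \<ge> m\<close>. Away
  from the poles the label is therefore locally constant.\<close>

lemma openin_theta_graph_edge:
  "openin (theta_graph m) {p \<in> topspace (theta_graph m). interior_point p \<and> edge p = e}"
proof -
  have "{x \<in> topspace (prod_topology (discrete_topology {..<m}) (top_of_set {0..1})).
      suspension_proj x \<in> {p \<in> topspace (theta_graph m). interior_point p \<and> edge p = e}}
    = ({e} \<inter> {..<m}) \<times> {0<..<1}"
    by (auto simp: interior_point_def Between_in_theta_graph split: if_splits)
  moreover have "openin (top_of_set {0..1::real}) {0<..<1}"
    by (rule open_subset) auto
  ultimately have "openin (prod_topology (discrete_topology {..<m}) (top_of_set {0..1}))
     {x \<in> topspace (prod_topology (discrete_topology {..<m}) (top_of_set {0..1})).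
      suspension_proj x \<in> {p \<in> topspace (theta_graph m). interior_point p \<and> edge p = e}}"
    by (simp add: openin_prod_Times_iff)
  then show ?thesis
    by (subst openin_theta_graph) auto
qed

text \<open>These finitely many arcs, poles included, are the closed cover used for pasting. The
  preimage of one arc also contains the ends of all other edges, since they are glued to the same
  poles.\<close>

lemma closedin_theta_graph_arc:
  assumes "e < m"
  shows "closedin (theta_graph m) ((\<lambda>t. suspension_proj (e, t)) ` {0..1})"
proof -
  have "{x \<in> topspace (prod_topology (discrete_topology {..<m}) (top_of_set {0..1})).
      suspension_proj x \<in> (\<lambda>t. suspension_proj (e, t)) ` {0..1}}
    = {e} \<times> {0..1} \<union> {..<m} \<times> {0, 1}"
    using assms by (auto simp: image_iff split: if_splits)
  moreover have "closedin (top_of_set {0..1::real}) {0, 1}" "closedin (top_of_set {0..1::real}) {0..1}"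
    by (auto intro: closed_subset)
  ultimately have "closedin (prod_topology (discrete_topology {..<m}) (top_of_set {0..1}))
     {x \<in> topspace (prod_topology (discrete_topology {..<m}) (top_of_set {0..1})).
      suspension_proj x \<in> (\<lambda>t. suspension_proj (e, t)) ` {0..1}}"
    using assms by (simp add: closedin_prod_Times_iff closedin_Un)
  moreover have "(\<lambda>t. suspension_proj (e, t)) ` {0..1} \<subseteq> topspace (theta_graph m)"
    using assms unfolding topspace_theta_graph by (intro image_subsetI imageI) simp
  ultimately show ?thesis
    by (subst closedin_theta_graph) auto
qed

text \<open>The poles stay fixed, so the motion is continuous only on sets that contain no pole other than
  one of height \<open>\<tau>\<close>.\<close>

definition move :: "real \<Rightarrow> real \<Rightarrow> 'a suspension_point \<Rightarrow> 'a suspension_point" where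
  "move \<tau> s p = set_height p ((1 - s) * height p + s * \<tau>)"

lemma convex_combination_bounds:
  fixes s :: real
  assumes "0 \<le> s" "s \<le> 1" "0 \<le> h" "h \<le> 1" "0 \<le> \<tau>" "\<tau> \<le> 1"
  shows "0 \<le> (1 - s) * h + s * \<tau>" "(1 - s) * h + s * \<tau> \<le> 1"
proof -
  show "0 \<le> (1 - s) * h + s * \<tau>" using assms by simp
  show "(1 - s) * h + s * \<tau> \<le> 1"
    using assms convex_bound_le[of h 1 \<tau> "1 - s" s] by simp
qed

text \<open>For \<open>s > 0\<close> the gap between the targets decides, for \<open>s = 0\<close>
  the gap between the initial heights. Hence strict order survives the motion.\<close>

lemma convex_combination_strict:
  fixes s :: real
  assumes "0 \<le> s" "s \<le> 1" "h < h'" "\<tau> < \<tau>'"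
  shows "(1 - s) * h + s * \<tau> < (1 - s) * h' + s * \<tau>'"
proof (cases "s = 0")
  case False
  then have "s * \<tau> < s * \<tau>'" "(1 - s) * h \<le> (1 - s) * h'"
    using assms by (auto intro: mult_left_mono)
  then show ?thesis by linarith
qed (use assms in auto)

lemma height_move:
  assumes "0 < height p \<and> height p < 1 \<or> p = South \<and> \<tau> = 0 \<or> p = North \<and> \<tau> = 1"
  shows "height (move \<tau> s p) = (1 - s) * height p + s * \<tau>"
  using assms by (cases p) (auto simp: move_def)

text \<open>On each closed arc the motion is the continuous formula
  \<open>suspension_proj (e, c z)\<close>. At a pole in \<open>R\<close> the hypotheses make that
  pole the target, so \<open>c\<close> is constant there and the formulas of all arcs agree.\<close>

lemma continuous_map_move:
  assumes R: "R \<subseteq> topspace (theta_graph m)" and \<tau>: "0 \<le> \<tau>" "\<tau> \<le> 1"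
    and S: "South \<in> R \<Longrightarrow> \<tau> = 0" and N: "North \<in> R \<Longrightarrow> \<tau> = 1"
  shows "continuous_map (prod_topology (top_of_set {0..1}) (subtopology (theta_graph m) R)) (theta_graph m)
           (\<lambda>z. move \<tau> (fst z) (snd z))"
proof -
  define X where "X = prod_topology (top_of_set {0..1::real}) (subtopology (theta_graph m) R)"
  have X: "topspace X = {0..1} \<times> R"
    using R by (auto simp: X_def topspace_subtopology_subset)
  define A where "A e = (\<lambda>t. suspension_proj (e, t)) ` {0..1}" for e :: nat
  define T where "T e = {z \<in> topspace X. snd z \<in> A e}" for e
  define c where "c z = (1 - fst z) * height (snd z) + fst z * \<tau>" for z :: "real \<times> nat suspension_point"
  have snd: "continuous_map X (theta_graph m) snd"
    unfolding X_def by (rule continuous_map_into_fulltopology[OF continuous_map_snd])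
  have fst: "continuous_map X euclideanreal fst"
    unfolding X_def by (rule continuous_map_into_fulltopology[OF continuous_map_fst])
  have h: "continuous_map X euclideanreal (\<lambda>z. height (snd z))"
    using continuous_map_compose[OF snd continuous_map_height] by (simp add: o_def)
  have "continuous_map X euclideanreal c"
    unfolding c_def by (intro continuous_intros fst h)
  moreover have c01: "c z \<in> {0..1}" if "z \<in> topspace X" for z
    using that convex_combination_bounds[of "fst z" "height (snd z)" \<tau>] \<tau> R height_bounds[of "snd z" m]
    by (auto simp: X c_def subset_iff)
  ultimately have c: "continuous_map X (top_of_set {0..1}) c"
    by (auto intro: continuous_map_into_subtopology)
  have "continuous_map X (theta_graph m) (\<lambda>z. move \<tau> (fst z) (snd z))"
  proof (rule pasting_lemma_closed[of "{..<m}" _ T _ "\<lambda>e z. suspension_proj (e, c z)"])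
    show "closedin X (T e)" if "e \<in> {..<m}" for e
      unfolding T_def using that closedin_theta_graph_arc
      by (intro closedin_continuous_map_preimage[OF snd]) (auto simp: A_def)
    show "continuous_map (subtopology X (T e)) (theta_graph m) (\<lambda>z. suspension_proj (e, c z))" if "e \<in> {..<m}" for e
      using continuous_map_compose[OF continuous_map_from_subtopology[OF c, of "T e"] continuous_map_suspension_proj, of e m]
        that by (simp add: o_def del: suspension_proj.simps)
    have arc: "move \<tau> (fst z) (snd z) = suspension_proj (e, c z)" if "z \<in> topspace X \<inter> T e" for e z
    proof -
      have "snd z \<in> A e" "snd z \<in> R" using that by (auto simp: T_def X)
      then show ?thesis
        using S N by (auto simp: A_def c_def move_def split: if_splits)
    qed
    show "suspension_proj (i, c z) = suspension_proj (j, c z)" if "i \<in> {..<m}" "j \<in> {..<m}" "z \<in> topspace X \<inter> T i \<inter> T j" for i j z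
      using arc[of z i] arc[of z j] that by auto
    show "\<exists>j. j \<in> {..<m} \<and> z \<in> T j \<and> move \<tau> (fst z) (snd z) = suspension_proj (j, c z)" if z: "z \<in> topspace X" for z
    proof -
      have "snd z \<in> topspace (theta_graph m)" using z R by (auto simp: X)
      then obtain j where "j < m" "snd z \<in> A j"
        unfolding topspace_theta_graph A_def by auto
      then show ?thesis using arc[of z j] z by (auto simp: T_def)
    qed
  qed auto
  then show ?thesis by (simp add: X_def)
qed

text \<open>All coordinates are moved simultaneously, coordinate \<open>i\<close> towards height
  \<open>\<tau> i\<close>. \<open>stays\<close> keeps the homotopy inside \<open>W\<close>, and
  \<open>target\<close> says that it ends at the single point \<open>b\<close>.\<close>

lemma contractible_space_move:
  assumes W: "W \<subseteq> topspace (product_topology (\<lambda>_. theta_graph m) I)"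
    and \<tau>: "\<And>i. i \<in> I \<Longrightarrow> 0 \<le> \<tau> i \<and> \<tau> i \<le> 1"
    and S: "\<And>x i. x \<in> W \<Longrightarrow> i \<in> I \<Longrightarrow> x i = South \<Longrightarrow> \<tau> i = 0"
    and N: "\<And>x i. x \<in> W \<Longrightarrow> i \<in> I \<Longrightarrow> x i = North \<Longrightarrow> \<tau> i = 1"
    and stays: "\<And>x s. x \<in> W \<Longrightarrow> 0 \<le> s \<Longrightarrow> s \<le> 1 \<Longrightarrow> (\<lambda>i\<in>I. move (\<tau> i) s (x i)) \<in> W"
    and target: "\<And>x. x \<in> W \<Longrightarrow> (\<lambda>i\<in>I. move (\<tau> i) 1 (x i)) = b"
  shows "contractible_space (subtopology (product_topology (\<lambda>_. theta_graph m) I) W)"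
proof -
  define P where "P = product_topology (\<lambda>_. theta_graph m) I"
  define X where "X = prod_topology (top_of_set {0..1::real}) (subtopology P W)"
  have Wt: "topspace (subtopology P W) = W"
    using W by (auto simp: P_def)
  have X: "topspace X = {0..1} \<times> W"
    using Wt by (simp add: X_def)
  define H where "H = (\<lambda>z :: real \<times> (_ \<Rightarrow> nat suspension_point). \<lambda>i\<in>I. move (\<tau> i) (fst z) (snd z i))"
  have cont: "continuous_map X (theta_graph m) (\<lambda>z. move (\<tau> i) (fst z) (snd z i))" if i: "i \<in> I" for i
  proof -
    \<comment> \<open>The values taken by coordinate \<open>i\<close> on \<open>W\<close>; this
      turns the conditions on tuples in \<open>W\<close> into those of
      \<open>continuous_map_move\<close>.\<close>
    define R where "R = (\<lambda>x. x i) ` W"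
    have R: "R \<subseteq> topspace (theta_graph m)"
      using W i by (auto simp: R_def)
    have fst: "continuous_map X (top_of_set {0..1}) fst"
      unfolding X_def by (rule continuous_map_fst)
    have "continuous_map X P snd"
      unfolding X_def by (rule continuous_map_into_fulltopology[OF continuous_map_snd])
    then have "continuous_map X (theta_graph m) (\<lambda>z. snd z i)"
      using i unfolding P_def by (auto simp: continuous_map_componentwise)
    then have "continuous_map X (subtopology (theta_graph m) R) (\<lambda>z. snd z i)"
      by (rule continuous_map_into_subtopology) (auto simp: X R_def)
    then have "continuous_map X (prod_topology (top_of_set {0..1}) (subtopology (theta_graph m) R)) (\<lambda>z. (fst z, snd z i))"
      by (intro continuous_map_pairedI fst)
    from continuous_map_compose[OF this continuous_map_move[OF R, of "\<tau> i"]]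
    show ?thesis
      using \<tau>[OF i] S[OF _ i] N[OF _ i] by (force simp: o_def R_def)
  qed
  have "continuous_map X P H"
    unfolding P_def continuous_map_componentwise using cont by (auto simp: H_def)
  then have "continuous_map X (subtopology P W) H"
    by (rule continuous_map_into_subtopology) (use stays in \<open>auto simp: X H_def\<close>)
  moreover have "H (0, x) = id x" if "x \<in> W" for x
  proof
    fix i
    have "x i \<in> topspace (theta_graph m)" if "i \<in> I"
      using \<open>x \<in> W\<close> W that by auto
    then show "H (0, x) i = id x i"
      using that W by (auto simp: H_def move_def restrict_def elim!: theta_graph_cases)
        (auto simp: PiE_iff extensional_def subset_iff)
  qed
  moreover have "H (1, x) = b" if "x \<in> W" for x
    using target[OF that] by (simp add: H_def)
  ultimately have "homotopic_with (\<lambda>x. True) (subtopology P W) (subtopology P W) id (\<lambda>x. b)"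
    using Wt by (subst homotopic_with) (auto simp: X_def)
  then show ?thesis
    unfolding contractible_space_def P_def by blast
qed

section \<open>Orbits of ordered configurations\<close>

lemma topspace_ordered_conf:
  "x \<in> topspace (ordered_conf n X) \<longleftrightarrow> x \<in> (\<Pi>\<^sub>E i\<in>{..<n}. topspace X) \<and> inj_on x {..<n}"
  by (simp add: ordered_conf_def)

lemma in_perm_orbit: "x \<in> perm_orbit n x"
  unfolding perm_orbit_def by (auto intro!: exI[of _ id] permutes_id)

text \<open>The underlying point set can be read off an orbit, so conditions on unordered
  configurations can be stated for sets of points.\<close>

lemma perm_orbit_points:
  "(\<Union>y\<in>perm_orbit n x. y ` {..<n}) = x ` {..<n}"
proof -
  have "(x \<circ> \<sigma>) ` {..<n} = x ` {..<n}" if "\<sigma> permutes {..<n}" for \<sigma>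
    using permutes_image[OF that] by (metis image_comp)
  then show ?thesis
    using in_perm_orbit[of x n] unfolding perm_orbit_def by blast
qed

lemma perm_orbit_comp:
  assumes "\<sigma> permutes {..<n}"
  shows "perm_orbit n (x \<circ> \<sigma>) = perm_orbit n x"
proof -
  have "x \<circ> \<rho> = (x \<circ> \<sigma>) \<circ> (inv_into UNIV \<sigma> \<circ> \<rho>)" for \<rho>
    using permutes_inv_o(1)[OF assms] by (metis comp_assoc comp_id)
  moreover have "(x \<circ> \<sigma>) \<circ> \<rho> = x \<circ> (\<sigma> \<circ> \<rho>)" for \<rho>
    by (simp add: o_assoc)
  ultimately show ?thesis
    unfolding perm_orbit_def using permutes_compose[OF _ assms] permutes_compose[OF _ permutes_inv[OF assms]]
    by blast
qed

lemma perm_orbit_eq_iff: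
  assumes "x \<in> topspace (ordered_conf n X)" "y \<in> topspace (ordered_conf n X)"
  shows "perm_orbit n x = perm_orbit n y \<longleftrightarrow> x ` {..<n} = y ` {..<n}"
proof
  assume "perm_orbit n x = perm_orbit n y"
  then show "x ` {..<n} = y ` {..<n}"
    using perm_orbit_points by metis
next
  assume eq: "x ` {..<n} = y ` {..<n}"
  \<comment> \<open>\<open>\<sigma> i\<close> is the index at which \<open>x\<close> takes the value
    \<open>y i\<close>; outside \<open>{..<n}\<close> it is the identity, as \<open>permutes\<close>
    demands.\<close>
  define \<sigma> where "\<sigma> i = (if i < n then inv_into {..<n} x (y i) else i)" for i
  have inj: "inj_on x {..<n}" "inj_on y {..<n}" and ext: "x \<in> extensional {..<n}" "y \<in> extensional {..<n}"
    using assms by (auto simp: topspace_ordered_conf PiE_iff)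
  have "bij_betw (inv_into {..<n} x \<circ> y) {..<n} {..<n}"
  proof (rule bij_betw_trans)
    show "bij_betw y {..<n} (x ` {..<n})"
      using inj eq by (simp add: bij_betw_def)
    show "bij_betw (inv_into {..<n} x) (x ` {..<n}) {..<n}"
      using inj by (simp add: bij_betw_inv_into inj_on_imp_bij_betw)
  qed
  then have "bij_betw \<sigma> {..<n} {..<n}"
    by (rule bij_betw_cong[THEN iffD1, rotated]) (auto simp: \<sigma>_def)
  then have \<sigma>: "\<sigma> permutes {..<n}"
    by (rule bij_imp_permutes) (auto simp: \<sigma>_def)
  have "y = x \<circ> \<sigma>"
  proof
    fix i show "y i = (x \<circ> \<sigma>) i"
    proof (cases "i < n")
      case True
      then have "y i \<in> x ` {..<n}" using eq by auto
      then show ?thesis using True by (simp add: \<sigma>_def f_inv_into_f)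
    next
      case False
      then show ?thesis
        using ext by (simp add: \<sigma>_def extensional_def)
    qed
  qed
  then show "perm_orbit n x = perm_orbit n y"
    using perm_orbit_comp[OF \<sigma>, of x] by simp
qed

section \<open>The orbit map as an open quotient map\<close>

lemma continuous_map_ordered_conf_permute:
  assumes \<sigma>: "\<sigma> permutes {..<n}"
  shows "continuous_map (ordered_conf n X) (ordered_conf n X) (\<lambda>x. x \<circ> \<sigma>)"
proof -
  have inj: "inj_on (x \<circ> \<sigma>) {..<n}" if "inj_on x {..<n}" for x :: "nat \<Rightarrow> 'a"
    using that \<sigma> by (intro comp_inj_on) (auto simp: permutes_inj_on permutes_image)
  have "continuous_map (product_topology (\<lambda>_. X) {..<n}) (product_topology (\<lambda>_. X) {..<n}) (\<lambda>x. x \<circ> \<sigma>)"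
    unfolding continuous_map_componentwise
  proof (intro conjI ballI image_subsetI)
    fix x assume "x \<in> topspace (product_topology (\<lambda>_. X) {..<n})"
    then show "x \<circ> \<sigma> \<in> extensional {..<n}"
      using permutes_not_in[OF \<sigma>] by (auto simp: extensional_def PiE_iff)
  next
    fix k assume "k \<in> {..<n}"
    then have "\<sigma> k \<in> {..<n}"
      using permutes_in_image[OF \<sigma>] by blast
    then show "continuous_map (product_topology (\<lambda>_. X) {..<n}) X (\<lambda>x. (x \<circ> \<sigma>) k)"
      using continuous_map_product_projection[of "\<sigma> k" "{..<n}" "\<lambda>_. X"] by simp
  qed
  then show ?thesis
    unfolding ordered_conf_def
    by (intro continuous_map_into_subtopology continuous_map_from_subtopology) (auto intro: inj)
qed

lemma openin_unordered_conf:
  "openin (unordered_conf n X) U \<longleftrightarrow> U \<subseteq> perm_orbit n ` topspace (ordered_conf n X) \<and>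
     openin (ordered_conf n X) {x \<in> topspace (ordered_conf n X). perm_orbit n x \<in> U}"
  unfolding unordered_conf_def by (rule openin_quotient_topology)

lemma topspace_unordered_conf:
  "topspace (unordered_conf n X) = perm_orbit n ` topspace (ordered_conf n X)"
  unfolding unordered_conf_def by (rule topspace_quotient_topology)

text \<open>The full preimage of the image of \<open>W\<close> is the union of the translates
  \<open>S \<sigma>\<close>, each open because permuting coordinates is continuous.\<close>

lemma open_map_perm_orbit: "open_map (ordered_conf n X) (unordered_conf n X) (perm_orbit n)"
  unfolding open_map_def
proof (intro allI impI)
  fix W assume W: "openin (ordered_conf n X) W"
  note WX = openin_subset[OF W]
  define S where "S \<sigma> = {x \<in> topspace (ordered_conf n X). x \<circ> \<sigma> \<in> W}" for \<sigma>
  have "{x \<in> topspace (ordered_conf n X). perm_orbit n x \<in> perm_orbit n ` W} = (\<Union>\<sigma>\<in>{\<sigma>. \<sigma> permutes {..<n}}. S \<sigma>)"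
  proof (intro subset_antisym subsetI)
    fix x assume "x \<in> {x \<in> topspace (ordered_conf n X). perm_orbit n x \<in> perm_orbit n ` W}"
    then obtain w where x: "x \<in> topspace (ordered_conf n X)" and w: "w \<in> W" "perm_orbit n x = perm_orbit n w"
      by auto
    then have "w \<in> perm_orbit n x"
      using in_perm_orbit[of w n] by simp
    then obtain \<sigma> where "\<sigma> permutes {..<n}" "w = x \<circ> \<sigma>"
      unfolding perm_orbit_def by auto
    then show "x \<in> (\<Union>\<sigma>\<in>{\<sigma>. \<sigma> permutes {..<n}}. S \<sigma>)"
      using x w unfolding S_def by blast
  next
    fix x assume "x \<in> (\<Union>\<sigma>\<in>{\<sigma>. \<sigma> permutes {..<n}}. S \<sigma>)"
    then obtain \<sigma> where "\<sigma> permutes {..<n}" "x \<in> topspace (ordered_conf n X)" "x \<circ> \<sigma> \<in> W"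
      by (auto simp: S_def)
    then show "x \<in> {x \<in> topspace (ordered_conf n X). perm_orbit n x \<in> perm_orbit n ` W}"
      using perm_orbit_comp[of \<sigma> n x] by (auto intro: rev_image_eqI)
  qed
  moreover have "openin (ordered_conf n X) (S \<sigma>)" if "\<sigma> permutes {..<n}" for \<sigma>
    unfolding S_def using openin_continuous_map_preimage[OF continuous_map_ordered_conf_permute[OF that] W] .
  ultimately show "openin (unordered_conf n X) (perm_orbit n ` W)"
    using WX by (auto simp: openin_unordered_conf intro!: openin_Union)
qed

text \<open>Since \<open>W\<close> meets every orbit at most once, the orbit map is injective on it;
  it is also continuous and open. Contractibility can thus be checked on ordered tuples.\<close>

lemma homeomorphic_space_unordered_conf:
  assumes W: "openin (ordered_conf n X) W"
    and inj: "\<And>x y. x \<in> W \<Longrightarrow> y \<in> W \<Longrightarrow> x ` {..<n} = y ` {..<n} \<Longrightarrow> x = y"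
  shows "subtopology (ordered_conf n X) W homeomorphic_space subtopology (unordered_conf n X) (perm_orbit n ` W)"
proof -
  have WX: "W \<subseteq> topspace (ordered_conf n X)"
    by (rule openin_subset[OF W])
  have open_map: "open_map (subtopology (ordered_conf n X) W) (subtopology (unordered_conf n X) (perm_orbit n ` W)) (perm_orbit n)"
    by (intro open_map_into_subtopology open_map_from_subtopology[OF open_map_perm_orbit W]) auto
  have "continuous_map (ordered_conf n X) (unordered_conf n X) (perm_orbit n)"
    unfolding unordered_conf_def by (rule quotient_imp_continuous_map[OF quotient_map_quotient_topology])
  then have cont: "continuous_map (subtopology (ordered_conf n X) W) (subtopology (unordered_conf n X) (perm_orbit n ` W)) (perm_orbit n)"
    by (intro continuous_map_into_subtopology continuous_map_from_subtopology) auto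
  have "inj_on (perm_orbit n) W"
  proof (rule inj_onI)
    fix x y assume "x \<in> W" "y \<in> W" "perm_orbit n x = perm_orbit n y"
    then show "x = y"
      using perm_orbit_points[of n x] perm_orbit_points[of n y] by (intro inj) auto
  qed
  then have "homeomorphic_map (subtopology (ordered_conf n X) W) (subtopology (unordered_conf n X) (perm_orbit n ` W)) (perm_orbit n)"
    using WX by (intro bijective_open_imp_homeomorphic_map cont open_map)
      (auto simp: topspace_unordered_conf Int_absorb1 image_mono)
  then show ?thesis
    by (rule homeomorphic_map_imp_homeomorphic_space)
qed

section \<open>Arrangements of three points\<close>

lemma image_lessThan_3: "f ` {..<3::nat} = {f 0, f 1, f 2}"
  by (auto simp: numeral_3_eq_3 numeral_2_eq_2 lessThan_Suc)

lemma less_3_cases: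
  assumes "i < (3::nat)"
  obtains "i = 0" | "i = 1" | "i = 2"
  using assms by (auto simp: numeral_3_eq_3 numeral_2_eq_2 less_Suc_eq)

lemma extensional_eqI_3:
  assumes "x \<in> extensional {..<3::nat}" "y \<in> extensional {..<3::nat}"
    and "x 0 = y 0" "x 1 = y 1" "x 2 = y 2"
  shows "x = y"
  using assms by (intro extensionalityI[of x "{..<3}" y]) (auto elim: less_3_cases)

definition triple :: "'a \<Rightarrow> 'a \<Rightarrow> 'a \<Rightarrow> nat \<Rightarrow> 'a" where
  "triple p q r = (\<lambda>i\<in>{..<3}. if i = 0 then p else if i = 1 then q else r)"

lemma triple_simps [simp]:
  "triple p q r 0 = p" "triple p q r (Suc 0) = q" "triple p q r 2 = r" "triple p q r \<in> extensional {..<3}"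
  by (simp_all add: triple_def)

definition lex_less :: "nat suspension_point \<Rightarrow> nat suspension_point \<Rightarrow> bool" where
  "lex_less p q \<longleftrightarrow> edge p < edge q \<or> edge p = edge q \<and> height p < height q"

text \<open>If \<open>lo\<close>, the first point is singled out as the strictly lowest one, and if \<open>hi\<close>, the last one as
  the strictly highest one. The remaining points are listed lexicographically.\<close>

definition arranged ::
  "bool \<Rightarrow> bool \<Rightarrow> nat suspension_point \<Rightarrow> nat suspension_point \<Rightarrow> nat suspension_point \<Rightarrow> bool" where
  "arranged lo hi p q r \<longleftrightarrow>
     (if lo then height p < height q \<and> height p < height r else lex_less p q) \<and>
     (if hi then height p < height r \<and> height q < height r else lex_less q r)"

lemma arranged_distinct:
  "arranged lo hi p q r \<Longrightarrow> p \<noteq> q \<and> p \<noteq> r \<and> q \<noteq> r"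
  by (auto simp: arranged_def lex_less_def split: if_splits)

lemma arranged_asym:
  assumes "arranged lo hi p q r"
  shows "\<not> arranged lo hi p r q" "\<not> arranged lo hi q p r" "\<not> arranged lo hi q r p"
    "\<not> arranged lo hi r p q" "\<not> arranged lo hi r q p"
proof -
  have asym: "lex_less u v \<Longrightarrow> \<not> lex_less v u" for u v
    by (auto simp: lex_less_def)
  have "lo \<Longrightarrow> height p < height q \<and> height p < height r" "\<not> lo \<Longrightarrow> lex_less p q"
    "hi \<Longrightarrow> height p < height r \<and> height q < height r" "\<not> hi \<Longrightarrow> lex_less q r"
    "\<not> lo \<Longrightarrow> \<not> hi \<Longrightarrow> lex_less p r"
    using assms by (auto simp: arranged_def lex_less_def)
  then show "\<not> arranged lo hi p r q" "\<not> arranged lo hi q p r" "\<not> arranged lo hi q r p"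
    "\<not> arranged lo hi r p q" "\<not> arranged lo hi r q p"
    unfolding arranged_def using asym less_asym[of "height p" "height q"] less_asym[of "height p" "height r"]
      less_asym[of "height q" "height r"]
    by (metis (full_types))+
qed

text \<open>Strict extremes are unique and the lexicographic order decides the rest, so no
  nontrivial permutation of an arranged triple is arranged. This selects one ordering in each
  orbit.\<close>

lemma arranged_unique:
  assumes a: "arranged lo hi p q r" "arranged lo hi p' q' r'" and eq: "{p, q, r} = {p', q', r'}"
  shows "p = p' \<and> q = q' \<and> r = r'"
proof -
  have "p \<noteq> q" "p \<noteq> r" "q \<noteq> r"
    using arranged_distinct[OF a(1)] by auto
  moreover have "p = p' \<or> p = q' \<or> p = r'" "q = p' \<or> q = q' \<or> q = r'" "r = p' \<or> r = q' \<or> r = r'"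
    using eq by blast+
  ultimately consider "p = p' \<and> q = q' \<and> r = r'" | "p = p' \<and> q = r' \<and> r = q'" | "p = q' \<and> q = p' \<and> r = r'"
    | "p = q' \<and> q = r' \<and> r = p'" | "p = r' \<and> q = p' \<and> r = q'" | "p = r' \<and> q = q' \<and> r = p'"
    by metis
  then show ?thesis
    using arranged_asym[OF a(1)] a(2) by cases blast+
qed

text \<open>For \<open>(lo, sl)\<close> equal to \<open>(False, False)\<close>, \<open>(True, True)\<close>, \<open>(True, False)\<close> these are the conditions
  U1, V1 and U1 \<open>\<inter>\<close> V1; the combination \<open>(False, True)\<close> is not used.\<close>

definition low_condition :: "bool \<Rightarrow> bool \<Rightarrow> nat suspension_point set \<Rightarrow> bool" where
  "low_condition lo sl D \<longleftrightarrow>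
     (lo \<longrightarrow> (\<exists>p\<in>D. \<forall>q\<in>D - {p}. height p < height q)) \<and> (\<not> sl \<longrightarrow> South \<notin> D)"

definition high_condition :: "bool \<Rightarrow> bool \<Rightarrow> nat suspension_point set \<Rightarrow> bool" where
  "high_condition hi sh D \<longleftrightarrow>
     (hi \<longrightarrow> (\<exists>p\<in>D. \<forall>q\<in>D - {p}. height q < height p)) \<and> (\<not> sh \<longrightarrow> North \<notin> D)"

lemma lex_less_total:
  assumes "p \<in> topspace (theta_graph m)" "q \<in> topspace (theta_graph m)"
    "interior_point p" "interior_point q" "p \<noteq> q"
  shows "lex_less p q \<or> lex_less q p"
  using assms by (cases p; cases q) (auto simp: lex_less_def interior_point_def)

text \<open>The singled-out extremes are placed first. Every remaining point is interior, being kept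
  from each pole either by an extreme beyond it or by the ban on that pole, and interior points are
  lexicographically comparable.\<close>

lemma arranged_exists:
  assumes D: "D = {p, q, r}" "p \<noteq> q" "p \<noteq> r" "q \<noteq> r" "D \<subseteq> topspace (theta_graph m)"
    and low: "low_condition lo sl D" and high: "high_condition hi sh D"
    and sl: "sl \<longrightarrow> lo" and sh: "sh \<longrightarrow> hi"
  obtains p' q' r' where "{p', q', r'} = D" "arranged lo hi p' q' r'"
    "sl \<or> interior_point p'" "interior_point q'" "sh \<or> interior_point r'"
proof -
  have pick: "\<exists>v w. D = {u, v, w} \<and> u \<noteq> v \<and> u \<noteq> w \<and> v \<noteq> w" if "u \<in> D" for u
  proof -
    have "{p, q, r} = {q, p, r}" "{p, q, r} = {r, p, q}" by auto
    then show ?thesis using that D(1-4) by blast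
  qed
  have total: "lex_less u v \<or> lex_less v u" if "u \<in> D" "v \<in> D" "interior_point u" "interior_point v" "u \<noteq> v" for u v
    using that D(5) lex_less_total by blast
  have bounds: "0 \<le> height u" "height u \<le> 1" if "u \<in> D" for u
    using that D(5) height_bounds by blast+
  have int: "interior_point u" if "u \<in> D" "u \<noteq> South" "u \<noteq> North" for u
    using that D(5) interior_point_theta_graph by blast
  have "\<exists>p' q' r'. {p', q', r'} = D \<and> arranged lo hi p' q' r'"
  proof (cases lo)
    case lo: True
    then obtain u where u: "u \<in> D" "\<And>v. v \<in> D \<Longrightarrow> v \<noteq> u \<Longrightarrow> height u < height v"
      using low by (auto simp: low_condition_def)
    show ?thesis
    proof (cases hi)
      case True
      then obtain w where w: "w \<in> D" "\<And>v. v \<in> D \<Longrightarrow> v \<noteq> w \<Longrightarrow> height v < height w"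
        using high by (auto simp: high_condition_def)
      obtain v1 v2 where v: "D = {u, v1, v2}" "u \<noteq> v1" "u \<noteq> v2" "v1 \<noteq> v2"
        using pick[OF u(1)] by blast
      \<comment> \<open>A further point \<open>v1\<close> lies strictly above \<open>u\<close>, so
        \<open>u\<close> cannot also be the highest point.\<close>
      have "w \<noteq> u"
        using w(2)[of v1] u(2)[of v1] v by auto
      then consider "w = v1" | "w = v2" using w(1) v(1) by auto
      then show ?thesis
      proof cases
        case 1
        then have "{u, v2, v1} = D \<and> arranged lo hi u v2 v1"
          using lo True v u(2)[of v1] u(2)[of v2] w(2)[of v2] by (auto simp: arranged_def)
        then show ?thesis by blast
      next
        case 2
        then have "{u, v1, v2} = D \<and> arranged lo hi u v1 v2"
          using lo True v u(2)[of v1] u(2)[of v2] w(2)[of v1] by (auto simp: arranged_def)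
        then show ?thesis by blast
      qed
    next
      case False
      obtain v1 v2 where v: "D = {u, v1, v2}" "u \<noteq> v1" "u \<noteq> v2" "v1 \<noteq> v2"
        using pick[OF u(1)] by blast
      have h: "height u < height v1" "height u < height v2"
        using u(2) v by auto
      \<comment> \<open>Without \<open>hi\<close> there is no \<open>sh\<close>, so North is banned;
        \<open>v1\<close> and \<open>v2\<close> differ from South because they lie above
        \<open>u\<close>.\<close>
      have "North \<notin> D"
        using high sh False by (auto simp: high_condition_def)
      then have "interior_point v1" "interior_point v2"
        using int[of v1] int[of v2] h bounds[of u] v by force+
      then have "lex_less v1 v2 \<or> lex_less v2 v1"
        using total v by auto
      then have "arranged lo hi u v1 v2 \<or> arranged lo hi u v2 v1"
        using lo False h by (auto simp: arranged_def)
      moreover have "{u, v1, v2} = D" "{u, v2, v1} = D"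
        using v by auto
      ultimately show ?thesis by blast
    qed
  next
    case lo: False
    then have noS: "South \<notin> D"
      using low sl by (auto simp: low_condition_def)
    show ?thesis
    proof (cases hi)
      case True
      then obtain w where w: "w \<in> D" "\<And>v. v \<in> D \<Longrightarrow> v \<noteq> w \<Longrightarrow> height v < height w"
        using high by (auto simp: high_condition_def)
      obtain v1 v2 where v: "D = {w, v1, v2}" "w \<noteq> v1" "w \<noteq> v2" "v1 \<noteq> v2"
        using pick[OF w(1)] by blast
      have h: "height v1 < height w" "height v2 < height w"
        using w(2) v by auto
      have "interior_point v1" "interior_point v2"
        using int[of v1] int[of v2] h bounds[of w] v noS by force+
      then have "lex_less v1 v2 \<or> lex_less v2 v1"
        using total v by auto
      then have "arranged lo hi v1 v2 w \<or> arranged lo hi v2 v1 w"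
        using lo True h by (auto simp: arranged_def)
      moreover have "{v1, v2, w} = D" "{v2, v1, w} = D"
        using v by auto
      ultimately show ?thesis by blast
    next
      case False
      have "North \<notin> D"
        using high sh False by (auto simp: high_condition_def)
      then have t: "lex_less u v \<or> lex_less v u" if "u \<in> D" "v \<in> D" "u \<noteq> v" for u v
        using total[of u v] int[of u] int[of v] noS that by blast
      have perms: "{p, q, r} = D" "{p, r, q} = D" "{q, p, r} = D" "{q, r, p} = D" "{r, p, q} = D" "{r, q, p} = D"
        using D(1) by auto
      have "lex_less p q \<or> lex_less q p" "lex_less p r \<or> lex_less r p" "lex_less q r \<or> lex_less r q"
        using t D by auto
      \<comment> \<open>Any choice of directions between three points contains a directed path
        through all of them, and \<open>arranged\<close> compares only consecutive points
        here.\<close>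
      then have "(lex_less p q \<and> lex_less q r) \<or> (lex_less p r \<and> lex_less r q) \<or> (lex_less q p \<and> lex_less p r) \<or>
         (lex_less q r \<and> lex_less r p) \<or> (lex_less r p \<and> lex_less p q) \<or> (lex_less r q \<and> lex_less q p)"
        by blast
      then show ?thesis
        using lo False perms by (simp add: arranged_def) blast
    qed
  qed
  then obtain p' q' r' where D': "{p', q', r'} = D" and arr: "arranged lo hi p' q' r'"
    by blast
  have low_ht: "lo \<Longrightarrow> height p' < height q' \<and> height p' < height r'"
    and high_ht: "hi \<Longrightarrow> height p' < height r' \<and> height q' < height r'"
    using arr by (auto simp: arranged_def)
  have noS: "\<not> sl \<Longrightarrow> South \<notin> D" and noN: "\<not> sh \<Longrightarrow> North \<notin> D"
    using low high by (auto simp: low_condition_def high_condition_def)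
  have in_D: "p' \<in> D" "q' \<in> D" "r' \<in> D"
    using D' by auto
  have S: "q' \<noteq> South" "r' \<noteq> South"
    using in_D noS sl low_ht bounds[of p'] by force+
  have N: "p' \<noteq> North" "q' \<noteq> North"
    using in_D noN sh high_ht bounds[of r'] by force+
  show thesis
    using D' arr int[of p'] int[of q'] int[of r'] in_D noS noN S N by (intro that[of p' q' r']) auto
qed

text \<open>The label of a point that has been singled out and may pass through a pole is \<open>0\<close>.\<close>

definition cell :: "nat \<Rightarrow> bool \<Rightarrow> bool \<Rightarrow> bool \<Rightarrow> bool \<Rightarrow> nat \<times> nat \<times> nat \<Rightarrow> (nat \<Rightarrow> nat suspension_point) set" where
  "cell m lo sl hi sh = (\<lambda>(a, b, c). {x \<in> (\<Pi>\<^sub>E i\<in>{..<3}. topspace (theta_graph m)).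
     (sl \<or> interior_point (x 0) \<and> edge (x 0) = a) \<and>
     (interior_point (x 1) \<and> edge (x 1) = b) \<and>
     (sh \<or> interior_point (x 2) \<and> edge (x 2) = c) \<and>
     (if lo then height (x 0) < height (x 1) \<and> height (x 0) < height (x 2)
      else a < b \<or> a = b \<and> height (x 0) < height (x 1)) \<and>
     (if hi then height (x 0) < height (x 2) \<and> height (x 1) < height (x 2)
      else b < c \<or> b = c \<and> height (x 1) < height (x 2))})"

text \<open>The bound 1 forces the dummy label 0. In a lexicographic comparison labels need only
  increase weakly, since points on one edge are ordered by height; these are exactly the labels of
  nonempty cells in that case.\<close>

definition cell_index :: "nat \<Rightarrow> bool \<Rightarrow> bool \<Rightarrow> bool \<Rightarrow> bool \<Rightarrow> (nat \<times> nat \<times> nat) set" where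
  "cell_index m lo sl hi sh = {(a, b, c). a < (if sl then 1 else m) \<and> b < m \<and> c < (if sh then 1 else m) \<and>
     (lo \<or> a \<le> b) \<and> (hi \<or> b \<le> c)}"

definition piece :: "nat \<Rightarrow> bool \<Rightarrow> bool \<Rightarrow> bool \<Rightarrow> bool \<Rightarrow> (nat \<Rightarrow> nat suspension_point) set set" where
  "piece m lo sl hi sh = {c \<in> topspace (unordered_conf 3 (theta_graph m)).
     low_condition lo sl (\<Union>x\<in>c. x ` {..<3}) \<and> high_condition hi sh (\<Union>x\<in>c. x ` {..<3})}"

lemma cellD:
  assumes "x \<in> cell m lo sl hi sh (a, b, c)" and sl: "sl \<longrightarrow> lo" and sh: "sh \<longrightarrow> hi"
  shows "arranged lo hi (x 0) (x 1) (x 2)"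
    and "x 0 \<in> topspace (theta_graph m)" "x 1 \<in> topspace (theta_graph m)" "x 2 \<in> topspace (theta_graph m)"
    and "x \<in> extensional {..<3}"
    and "sl \<or> interior_point (x 0)" "interior_point (x 1)" "sh \<or> interior_point (x 2)"
    and "x 0 \<noteq> North" "x 2 \<noteq> South"
proof -
  have x: "x \<in> (\<Pi>\<^sub>E i\<in>{..<3}. topspace (theta_graph m))"
     and "sl \<or> interior_point (x 0) \<and> edge (x 0) = a"
     "interior_point (x 1) \<and> edge (x 1) = b"
     "sh \<or> interior_point (x 2) \<and> edge (x 2) = c"
     "if lo then height (x 0) < height (x 1) \<and> height (x 0) < height (x 2)
      else a < b \<or> a = b \<and> height (x 0) < height (x 1)"
     "if hi then height (x 0) < height (x 2) \<and> height (x 1) < height (x 2)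
      else b < c \<or> b = c \<and> height (x 1) < height (x 2)"
    using assms(1) by (simp_all add: cell_def del: One_nat_def)
  note c = this
  show "arranged lo hi (x 0) (x 1) (x 2)"
    using c sl sh by (auto simp: arranged_def lex_less_def simp del: One_nat_def split: if_splits)
  show "x 0 \<in> topspace (theta_graph m)" "x 1 \<in> topspace (theta_graph m)" "x 2 \<in> topspace (theta_graph m)"
    "x \<in> extensional {..<3}"
    using x by (auto simp: PiE_iff)
  show i: "sl \<or> interior_point (x 0)" "interior_point (x 1)" "sh \<or> interior_point (x 2)"
    using c by auto
  show "x 0 \<noteq> North"
    using c(2,3,5) sl by (auto simp: interior_point_def split: if_splits)
  show "x 2 \<noteq> South"
    using c(3,4,6) sh by (auto simp: interior_point_def split: if_splits)
qed

section \<open>Contractible cells\<close>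

lemma openin_Collect_conj:
  assumes "openin X {x \<in> topspace X. P x}" "openin X {x \<in> topspace X. Q x}"
  shows "openin X {x \<in> topspace X. P x \<and> Q x}"
proof -
  have "{x \<in> topspace X. P x \<and> Q x} = {x \<in> topspace X. P x} \<inter> {x \<in> topspace X. Q x}" by auto
  then show ?thesis using assms by (simp only: openin_Int)
qed

lemma openin_Collect_disj:
  assumes "openin X {x \<in> topspace X. P x}" "openin X {x \<in> topspace X. Q x}"
  shows "openin X {x \<in> topspace X. P x \<or> Q x}"
proof -
  have "{x \<in> topspace X. P x \<or> Q x} = {x \<in> topspace X. P x} \<union> {x \<in> topspace X. Q x}" by auto
  then show ?thesis using assms by (simp only: openin_Un)
qed

lemma openin_Collect_const: "openin X {x \<in> topspace X. c}"
  by (cases c) auto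

lemma openin_Collect_less:
  assumes "continuous_map X euclideanreal f" "continuous_map X euclideanreal g"
  shows "openin X {x \<in> topspace X. f x < g x}"
proof -
  have "continuous_map X euclideanreal (\<lambda>x. g x - f x)"
    using assms by (intro continuous_intros)
  from openin_continuous_map_preimage[OF this, of "{0<..}"] show ?thesis
    by simp
qed

lemma cell_subset_ordered_conf:
  assumes "sl \<longrightarrow> lo" "sh \<longrightarrow> hi"
  shows "cell m lo sl hi sh l \<subseteq> topspace (ordered_conf 3 (theta_graph m))"
proof
  fix x assume x: "x \<in> cell m lo sl hi sh l"
  obtain a b c where l: "l = (a, b, c)" by (cases l)
  note x = x[unfolded l]
  have "x 0 \<noteq> x 1 \<and> x 0 \<noteq> x 2 \<and> x 1 \<noteq> x 2"
    by (rule arranged_distinct[OF cellD(1)[OF x assms]])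
  then have "inj_on x {..<3}"
    by (intro inj_onI) (auto elim!: less_3_cases)
  then show "x \<in> topspace (ordered_conf 3 (theta_graph m))"
    using x by (simp add: topspace_ordered_conf cell_def)
qed

lemma continuous_map_ordered_conf_component:
  assumes "i < n"
  shows "continuous_map (ordered_conf n X) X (\<lambda>x. x i)"
  unfolding ordered_conf_def
  using assms by (intro continuous_map_from_subtopology continuous_map_product_projection) simp

text \<open>The cell is cut out by strict inequalities between continuous heights, by open edges,
  and by conditions on the labels alone, which do not depend on the point.\<close>

lemma openin_cell:
  assumes "sl \<longrightarrow> lo" "sh \<longrightarrow> hi"
  shows "openin (ordered_conf 3 (theta_graph m)) (cell m lo sl hi sh l)"
proof -
  obtain a b c where l: "l = (a, b, c)" by (cases l)
  let ?F = "ordered_conf 3 (theta_graph m)"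
  have comp: "continuous_map ?F (theta_graph m) (\<lambda>x. x i)" if "i < 3" for i
    using continuous_map_ordered_conf_component[OF that] .
  have h: "continuous_map ?F euclideanreal (\<lambda>x. height (x i))" if "i < 3" for i
    using continuous_map_compose[OF comp[OF that] continuous_map_height] by (simp add: o_def)
  have less: "openin ?F {x \<in> topspace ?F. height (x i) < height (x j)}" if "i < 3" "j < 3" for i j
    using that by (intro openin_Collect_less h)
  have edge: "openin ?F {x \<in> topspace ?F. interior_point (x i) \<and> edge (x i) = e}" if "i < 3" for i e
  proof -
    have "{x \<in> topspace ?F. x i \<in> {p \<in> topspace (theta_graph m). interior_point p \<and> edge p = e}}
        = {x \<in> topspace ?F. interior_point (x i) \<and> edge (x i) = e}"
      using that by (auto simp: topspace_ordered_conf)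
    then show ?thesis
      using openin_continuous_map_preimage[OF comp[OF that] openin_theta_graph_edge[of m e]] by simp
  qed
  let ?P = "\<lambda>x. (sl \<or> interior_point (x 0) \<and> edge (x 0) = a) \<and>
     (interior_point (x 1) \<and> edge (x 1) = b) \<and>
     (sh \<or> interior_point (x 2) \<and> edge (x 2) = c) \<and>
     (if lo then height (x 0) < height (x 1) \<and> height (x 0) < height (x 2)
      else a < b \<or> a = b \<and> height (x 0) < height (x 1)) \<and>
     (if hi then height (x 0) < height (x 2) \<and> height (x 1) < height (x 2)
      else b < c \<or> b = c \<and> height (x 1) < height (x 2))"
  have "openin ?F {x \<in> topspace ?F. ?P x}"
    by (cases lo; cases hi; simp only: if_True if_False;
        intro openin_Collect_conj openin_Collect_disj openin_Collect_const less edge; simp)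
  moreover have "cell m lo sl hi sh l = {x \<in> topspace ?F. ?P x}"
    using cell_subset_ordered_conf[OF assms, where m = m and l = l] unfolding l cell_def prod.case
    by (auto simp only: topspace_ordered_conf subset_iff mem_Collect_eq)
  ultimately show ?thesis
    by simp
qed

text \<open>The values only have to increase strictly along the three positions, with a pole for a
  point allowed to reach it and an interior height otherwise.\<close>

definition cell_height :: "bool \<Rightarrow> bool \<Rightarrow> nat \<Rightarrow> real" where
  "cell_height sl sh = triple (if sl then 0 else 1 / 4) (1 / 2) (if sh then 1 else 3 / 4)"

definition cell_center :: "bool \<Rightarrow> bool \<Rightarrow> nat \<times> nat \<times> nat \<Rightarrow> nat \<Rightarrow> nat suspension_point" where
  "cell_center sl sh = (\<lambda>(a, b, c). triple (if sl then South else Between a (1 / 4)) (Between b (1 / 2))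
     (if sh then North else Between c (3 / 4)))"

lemma cell_nonempty:
  assumes "l \<in> cell_index m lo sl hi sh"
  shows "cell_center sl sh l \<in> cell m lo sl hi sh l"
proof -
  obtain a b c where l: "l = (a, b, c)" by (cases l)
  have abc: "a < (if sl then 1 else m)" "b < m" "c < (if sh then 1 else m)" "lo \<or> a \<le> b" "hi \<or> b \<le> c"
    using assms by (auto simp: l cell_index_def)
  then have "m \<ge> 1" by auto
  then have "cell_center sl sh l \<in> (\<Pi>\<^sub>E i\<in>{..<3}. topspace (theta_graph m))"
    using abc by (auto simp: l cell_center_def PiE_iff Between_in_theta_graph poles_in_theta_graph elim!: less_3_cases)
  moreover have "lo \<or> a < b \<or> a = b" "hi \<or> b < c \<or> b = c"
    using abc(4,5) by auto
  ultimately show ?thesis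
    by (cases sl; cases sh; cases lo; cases hi) (simp_all add: l cell_def cell_center_def interior_point_def)
qed

lemma move_in_theta_graph:
  assumes "p \<in> topspace (theta_graph m)" "0 \<le> s" "s \<le> 1" "0 \<le> \<tau>" "\<tau> \<le> 1"
  shows "move \<tau> s p \<in> topspace (theta_graph m)"
  using assms(1)
proof (cases rule: theta_graph_cases)
  case (3 e t)
  then have "0 \<le> (1 - s) * t + s * \<tau>" "(1 - s) * t + s * \<tau> \<le> 1"
    using assms convex_combination_bounds[of s t \<tau>] by auto
  then show ?thesis
    using 3 unfolding topspace_theta_graph move_def
    by (auto simp del: suspension_proj.simps intro!: imageI)
qed (use assms(1) in \<open>auto simp: move_def\<close>)

lemma interior_point_move:
  assumes "interior_point p" "0 \<le> s" "s \<le> 1" "0 < \<tau>" "\<tau> < 1"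
  shows "interior_point (move \<tau> s p) \<and> edge (move \<tau> s p) = edge p"
proof -
  have "0 < (1 - s) * height p + s * \<tau>" "(1 - s) * height p + s * \<tau> < 1"
    using assms convex_combination_strict[of s 0 "height p" 0 \<tau>] convex_combination_strict[of s "height p" 1 \<tau> 1]
    by (auto simp: interior_point_def)
  then show ?thesis
    using assms by (cases p) (auto simp: move_def interior_point_def)
qed

text \<open>Every height comparison in a cell is from a smaller to a larger position, and so are the
  targets; the linear motion therefore preserves it. Points with a label have interior targets and
  stay on their edges.\<close>

lemma contractible_space_cell:
  assumes sl: "sl \<longrightarrow> lo" and sh: "sh \<longrightarrow> hi"
  shows "contractible_space (subtopology (ordered_conf 3 (theta_graph m)) (cell m lo sl hi sh l))"
proof -
  obtain a b c where l: "l = (a, b, c)" by (cases l)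
  define W where "W = cell m lo sl hi sh (a, b, c)"
  let ?\<tau> = "cell_height sl sh"
  have \<tau>: "0 \<le> ?\<tau> i \<and> ?\<tau> i \<le> 1" if "i < 3" for i
    using that by (auto simp: cell_height_def elim!: less_3_cases)
  have W_conf: "W \<subseteq> topspace (ordered_conf 3 (theta_graph m))"
    unfolding W_def by (rule cell_subset_ordered_conf[OF sl sh])
  have "contractible_space (subtopology (product_topology (\<lambda>_. theta_graph m) {..<3}) W)"
  proof (rule contractible_space_move[where \<tau> = ?\<tau> and b = "cell_center sl sh (a, b, c)"])
    show "W \<subseteq> topspace (product_topology (\<lambda>_. theta_graph m) {..<3})"
      by (auto simp: W_def cell_def)
    show "0 \<le> ?\<tau> i \<and> ?\<tau> i \<le> 1" if "i \<in> {..<3}" for i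
      using \<tau> that by simp
    fix x assume x: "x \<in> W"
    note D = cellD[OF x[unfolded W_def] sl sh]
    \<comment> \<open>South can occur only at position 0 and only if \<open>sl\<close> holds, and
      then the target is South itself. The case of North is symmetric.\<close>
    show "?\<tau> i = 0" if "i \<in> {..<3}" "x i = South" for i
      using that D(6-10) by (auto simp: cell_height_def interior_point_def elim!: less_3_cases)
    show "?\<tau> i = 1" if "i \<in> {..<3}" "x i = North" for i
      using that D(6-10) by (auto simp: cell_height_def interior_point_def elim!: less_3_cases)
    have x_eq: "sl \<or> edge (x 0) = a" "edge (x 1) = b" "sh \<or> edge (x 2) = c"
      and lo_hi: "if lo then height (x 0) < height (x 1) \<and> height (x 0) < height (x 2)
      else a < b \<or> a = b \<and> height (x 0) < height (x 1)"
      "if hi then height (x 0) < height (x 2) \<and> height (x 1) < height (x 2)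
      else b < c \<or> b = c \<and> height (x 1) < height (x 2)"
      using x by (auto simp: W_def cell_def simp del: One_nat_def)
    show "(\<lambda>i\<in>{..<3}. move (?\<tau> i) 1 (x i)) = cell_center sl sh (a, b, c)"
    proof (rule extensional_eqI_3)
      show "(\<lambda>i\<in>{..<3}. move (?\<tau> i) 1 (x i)) 0 = cell_center sl sh (a, b, c) 0"
        using D(6,9) x_eq(1) by (cases "x 0") (auto simp: cell_height_def cell_center_def move_def interior_point_def)
      show "(\<lambda>i\<in>{..<3}. move (?\<tau> i) 1 (x i)) 1 = cell_center sl sh (a, b, c) 1"
        using D(7) x_eq(2) by (cases "x 1") (auto simp: cell_height_def cell_center_def move_def interior_point_def)
      show "(\<lambda>i\<in>{..<3}. move (?\<tau> i) 1 (x i)) 2 = cell_center sl sh (a, b, c) 2"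
        using D(8,10) x_eq(3) by (cases "x 2") (auto simp: cell_height_def cell_center_def move_def interior_point_def)
    qed (auto simp: cell_center_def)
    fix s :: real assume s: "0 \<le> s" "s \<le> 1"
    define y where "y = (\<lambda>i\<in>{..<3}. move (?\<tau> i) s (x i))"
    have y: "y 0 = move (?\<tau> 0) s (x 0)" "y 1 = move (?\<tau> 1) s (x 1)" "y 2 = move (?\<tau> 2) s (x 2)"
      by (simp_all add: y_def)
    have 0: "sl \<or> interior_point (y 0) \<and> edge (y 0) = a"
      using D(6) x_eq(1) interior_point_move[of "x 0" s "1/4"] s
      by (auto simp: y cell_height_def simp del: One_nat_def)
    have 1: "interior_point (y 1) \<and> edge (y 1) = b"
      unfolding y using D(7) x_eq(2) interior_point_move[of "x 1" s "1/2"] s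
      by (auto simp: cell_height_def)
    have 2: "sh \<or> interior_point (y 2) \<and> edge (y 2) = c"
      using D(8) x_eq(3) interior_point_move[of "x 2" s "3/4"] s
      by (auto simp: y cell_height_def simp del: One_nat_def)
    have h0: "height (y 0) = (1 - s) * height (x 0) + s * ?\<tau> 0"
      unfolding y using D(2) D(6,9)
      by (intro height_move) (auto elim!: theta_graph_cases simp: cell_height_def interior_point_def)
    have h1: "height (y 1) = (1 - s) * height (x 1) + s * ?\<tau> 1"
      unfolding y using D(7) by (intro height_move) (auto simp: interior_point_def)
    have h2: "height (y 2) = (1 - s) * height (x 2) + s * ?\<tau> 2"
      unfolding y using D(4) D(8,10)
      by (intro height_move) (auto elim!: theta_graph_cases simp: cell_height_def interior_point_def)
    have \<tau>_less: "?\<tau> 0 < ?\<tau> 1" "?\<tau> 1 < ?\<tau> 2" "?\<tau> 0 < ?\<tau> 2"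
      by (auto simp: cell_height_def)
    have mono: "height (x 0) < height (x 1) \<Longrightarrow> height (y 0) < height (y 1)"
      "height (x 1) < height (x 2) \<Longrightarrow> height (y 1) < height (y 2)"
      "height (x 0) < height (x 2) \<Longrightarrow> height (y 0) < height (y 2)"
      unfolding h0 h1 h2 using \<tau>_less s by (auto intro: convex_combination_strict)
    have "y \<in> (\<Pi>\<^sub>E i\<in>{..<3}. topspace (theta_graph m))"
      using x \<tau> s by (auto simp: y_def W_def cell_def PiE_iff intro!: move_in_theta_graph)
    then show "y \<in> W"
      using 0 1 2 mono lo_hi unfolding W_def cell_def by (auto split: if_splits simp del: One_nat_def)
  qed
  \<comment> \<open>Tuples in a cell are injective, so staying in \<open>W\<close> already rules out
    collisions and the product topology may be used.\<close>
  moreover have "subtopology (ordered_conf 3 (theta_graph m)) W = subtopology (product_topology (\<lambda>_. theta_graph m) {..<3}) W"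
  proof -
    have "{x. inj_on x {..<3::nat}} \<inter> W = W"
      using W_conf by (auto simp: topspace_ordered_conf subset_iff)
    then show ?thesis
      by (simp add: ordered_conf_def subtopology_subtopology)
  qed
  ultimately show ?thesis
    by (simp add: W_def l)
qed

text \<open>Arranging the points of a configuration puts it into some cell; conversely, the first
  and last entries of a tuple in a cell witness the required extremes.\<close>

lemma piece_eq_cells:
  assumes sl: "sl \<longrightarrow> lo" and sh: "sh \<longrightarrow> hi"
  shows "piece m lo sl hi sh = (\<Union>l\<in>cell_index m lo sl hi sh. perm_orbit 3 ` cell m lo sl hi sh l)"
proof (intro subset_antisym subsetI)
  fix z assume "z \<in> piece m lo sl hi sh"
  then obtain x where z: "z = perm_orbit 3 x" and x: "x \<in> topspace (ordered_conf 3 (theta_graph m))"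
    and low: "low_condition lo sl (x ` {..<3})" and high: "high_condition hi sh (x ` {..<3})"
    by (auto simp: piece_def topspace_unordered_conf perm_orbit_points)
  have "inj_on x {..<3}"
    using x by (simp add: topspace_ordered_conf)
  then have "x 0 \<noteq> x 1" "x 0 \<noteq> x 2" "x 1 \<noteq> x 2"
    by (simp_all add: inj_on_eq_iff)
  moreover have sub: "x ` {..<3} \<subseteq> topspace (theta_graph m)"
    using x by (auto simp: topspace_ordered_conf)
  ultimately obtain p q r where pqr: "{p, q, r} = x ` {..<3}" "arranged lo hi p q r"
    "sl \<or> interior_point p" "interior_point q" "sh \<or> interior_point r"
    using arranged_exists[OF image_lessThan_3, of x m lo sl hi sh] low high sl sh by blast
  define y where "y = triple p q r"
  define l where "l = (if sl then 0 else edge p, edge q, if sh then 0 else edge r)"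
  have pts: "p \<in> topspace (theta_graph m)" "q \<in> topspace (theta_graph m)" "r \<in> topspace (theta_graph m)"
    using pqr(1) sub by blast+
  have y: "y \<in> cell m lo sl hi sh l"
    using pqr(2-5) pts sl sh
    by (auto simp: l_def y_def cell_def arranged_def lex_less_def PiE_iff elim!: less_3_cases split: if_splits)
  have "l \<in> cell_index m lo sl hi sh"
    using pqr(2-5) pts sl sh edge_less[of p m] edge_less[of q m] edge_less[of r m]
    by (auto simp: l_def cell_index_def arranged_def lex_less_def split: if_splits)
  moreover have "perm_orbit 3 y = z"
    unfolding z using subsetD[OF cell_subset_ordered_conf[OF sl sh] y] x pqr(1)
    by (subst perm_orbit_eq_iff[of _ _ "theta_graph m"]) (auto simp: image_lessThan_3 y_def)
  ultimately show "z \<in> (\<Union>l\<in>cell_index m lo sl hi sh. perm_orbit 3 ` cell m lo sl hi sh l)"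
    using y by blast
next
  fix z assume "z \<in> (\<Union>l\<in>cell_index m lo sl hi sh. perm_orbit 3 ` cell m lo sl hi sh l)"
  then obtain a b c x where z: "z = perm_orbit 3 x" and x: "x \<in> cell m lo sl hi sh (a, b, c)"
    by auto
  note D = cellD[OF x sl sh]
  have "low_condition lo sl (x ` {..<3})" "high_condition hi sh (x ` {..<3})"
    using D(1,6-10) sl sh
    by (auto simp: low_condition_def high_condition_def image_lessThan_3 arranged_def interior_point_def
        split: if_splits)
  moreover have "x \<in> topspace (ordered_conf 3 (theta_graph m))"
    by (rule subsetD[OF cell_subset_ordered_conf[OF sl sh] x])
  ultimately show "z \<in> piece m lo sl hi sh"
    by (simp add: z piece_def topspace_unordered_conf perm_orbit_points)
qed

lemma finite_cell_index: "finite (cell_index m lo sl hi sh)"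
proof (rule finite_subset)
  show "cell_index m lo sl hi sh \<subseteq> {..m} \<times> {..m} \<times> {..m}"
    by (auto simp: cell_index_def split: if_splits)
qed auto

lemma openin_perm_orbit_cell:
  assumes "sl \<longrightarrow> lo" "sh \<longrightarrow> hi"
  shows "openin (unordered_conf 3 (theta_graph m)) (perm_orbit 3 ` cell m lo sl hi sh l)"
  using open_map_perm_orbit openin_cell[OF assms] unfolding open_map_def by blast

lemma openin_piece:
  assumes "sl \<longrightarrow> lo" "sh \<longrightarrow> hi"
  shows "openin (unordered_conf 3 (theta_graph m)) (piece m lo sl hi sh)"
  unfolding piece_eq_cells[OF assms] by (intro openin_Union) (auto intro: openin_perm_orbit_cell[OF assms])

text \<open>Allowing two labels serves two purposes: with \<open>l = l'\<close> the orbit map is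
  injective on a cell, and with different labels the images of the cells are disjoint.\<close>

lemma cell_unique:
  assumes x: "x \<in> cell m lo sl hi sh l" and y: "y \<in> cell m lo sl hi sh l'"
    and eq: "x ` {..<3} = y ` {..<3}" and sl: "sl \<longrightarrow> lo" and sh: "sh \<longrightarrow> hi"
  shows "x = y"
proof -
  obtain a b c a' b' c' where l: "l = (a, b, c)" "l' = (a', b', c')" by (cases l; cases l')
  note X = cellD[OF x[unfolded l] sl sh] and Y = cellD[OF y[unfolded l] sl sh]
  have "x 0 = y 0 \<and> x 1 = y 1 \<and> x 2 = y 2"
    using arranged_unique[OF X(1) Y(1)] eq by (simp add: image_lessThan_3)
  then show ?thesis
    using X(5) Y(5) by (intro extensional_eqI_3) auto
qed

lemma euler_characteristic_piece:
  assumes sl: "sl \<longrightarrow> lo" and sh: "sh \<longrightarrow> hi"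
  shows "euler_characteristic_defined (subtopology (unordered_conf 3 (theta_graph m)) (piece m lo sl hi sh)) \<and>
    euler_characteristic (subtopology (unordered_conf 3 (theta_graph m)) (piece m lo sl hi sh))
      = int (card (cell_index m lo sl hi sh))"
  unfolding piece_eq_cells[OF assms]
proof (rule euler_characteristic_disjoint_contractible)
  show "disjoint_family_on (\<lambda>l. perm_orbit 3 ` cell m lo sl hi sh l) (cell_index m lo sl hi sh)"
    unfolding disjoint_family_on_def
  proof (intro ballI impI equals0I)
    fix l l' z
    assume l: "l \<in> cell_index m lo sl hi sh" "l' \<in> cell_index m lo sl hi sh" "l \<noteq> l'"
      and "z \<in> perm_orbit 3 ` cell m lo sl hi sh l \<inter> perm_orbit 3 ` cell m lo sl hi sh l'"
    then obtain x y where x: "x \<in> cell m lo sl hi sh l" and y: "y \<in> cell m lo sl hi sh l'"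
      and "perm_orbit 3 x = perm_orbit 3 y"
      by auto
    then have "x ` {..<3} = y ` {..<3}"
      using perm_orbit_points[of 3 x] perm_orbit_points[of 3 y] by simp
    then have "x = y"
      by (rule cell_unique[OF x y _ sl sh])
    obtain a b c a' b' c' where abc: "l = (a, b, c)" "l' = (a', b', c')"
      by (cases l; cases l')
    have "sl \<or> edge (x 0) = a" "edge (x 1) = b" "sh \<or> edge (x 2) = c"
      using x by (auto simp: abc cell_def simp del: One_nat_def)
    moreover have "sl \<or> edge (x 0) = a'" "edge (x 1) = b'" "sh \<or> edge (x 2) = c'"
      using y \<open>x = y\<close> by (auto simp: abc cell_def simp del: One_nat_def)
    \<comment> \<open>A singled-out point that may reach its pole does not determine its label, but
      the index set admits only 0 for it.\<close>
    moreover have "sl \<longrightarrow> a = a'" "sh \<longrightarrow> c = c'"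
      using l by (auto simp: abc cell_index_def)
    ultimately show False
      using l(3) abc by auto
  qed
  fix l assume l: "l \<in> cell_index m lo sl hi sh"
  have "subtopology (ordered_conf 3 (theta_graph m)) (cell m lo sl hi sh l) homeomorphic_space
      subtopology (unordered_conf 3 (theta_graph m)) (perm_orbit 3 ` cell m lo sl hi sh l)"
    by (rule homeomorphic_space_unordered_conf[OF openin_cell[OF assms]]) (auto intro: cell_unique[OF _ _ _ sl sh])
  then show "contractible_space (subtopology (unordered_conf 3 (theta_graph m)) (perm_orbit 3 ` cell m lo sl hi sh l))"
    using contractible_space_cell[OF assms, where m = m and l = l] homeomorphic_space_contractibility by blast
  show "perm_orbit 3 ` cell m lo sl hi sh l \<noteq> {}"
    using cell_nonempty[OF l] by blast
qed (use finite_cell_index openin_perm_orbit_cell[OF assms] in auto)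

section \<open>Counting cells\<close>

text \<open>These are two-element multisets of labels; the induction splits off the pairs whose last
  entry is the new label.\<close>

lemma double_card_weakly_increasing_pairs: "2 * card {(a, b). a \<le> b \<and> b < m} = m * (m + 1 :: nat)"
proof (induction m)
  case (Suc m)
  have eq: "{(a, b). a \<le> b \<and> b < Suc m} = {(a, b). a \<le> b \<and> b < m} \<union> (\<lambda>a. (a, m)) ` {..m}"
    by auto
  have "finite {(a, b). a \<le> b \<and> b < m}"
    by (rule finite_subset[of _ "{..m} \<times> {..m}"]) auto
  then have "card {(a, b). a \<le> b \<and> b < Suc m} = card {(a, b). a \<le> b \<and> b < m} + (m + 1)"
    unfolding eq by (subst card_Un_disjoint) (auto simp: card_image inj_on_def)
  then show ?case using Suc by simp
qed simp

text \<open>As for pairs: triples ending in the new label correspond to weakly increasing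
  pairs.\<close>

lemma card_weakly_increasing_triples:
  "6 * card {(a, b, c). a \<le> b \<and> b \<le> c \<and> c < m} = m * (m + 1) * (m + 2 :: nat)"
proof (induction m)
  case (Suc m)
  have eq: "{(a, b, c). a \<le> b \<and> b \<le> c \<and> c < Suc m}
      = {(a, b, c). a \<le> b \<and> b \<le> c \<and> c < m} \<union> (\<lambda>(a, b). (a, b, m)) ` {(a, b). a \<le> b \<and> b < Suc m}"
    by (auto simp: image_iff)
  have fin: "finite {(a, b, c). a \<le> b \<and> b \<le> c \<and> c < m}"
    by (rule finite_subset[of _ "{..m} \<times> {..m} \<times> {..m}"]) auto
  have fin': "finite {(a, b). a \<le> b \<and> b < Suc m}"
    by (rule finite_subset[of _ "{..m} \<times> {..m}"]) auto
  have "card {(a, b, c). a \<le> b \<and> b \<le> c \<and> c < Suc m}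
      = card {(a, b, c). a \<le> b \<and> b \<le> c \<and> c < m} + card {(a, b). a \<le> b \<and> b < Suc m}"
    unfolding eq using fin fin'
    by (subst card_Un_disjoint) (auto simp: inj_on_def intro!: card_image)
  then show ?case using Suc double_card_weakly_increasing_pairs[of "Suc m"] by (simp add: algebra_simps)
qed simp

text \<open>Singling out a point decouples its label from the others, so each index set is a
  product, with factor 1 or \<open>m\<close> according to whether the pole may be reached.\<close>

lemma card_cell_index:
  fixes m
  defines "p \<equiv> card {(a, b). a \<le> b \<and> b < m}" and "t \<equiv> card {(a, b, c). a \<le> b \<and> b \<le> c \<and> c < m}"
  shows "card (cell_index m False False False False) = t"
    and "card (cell_index m True sl False False) = (if sl then 1 else m) * p"
    and "card (cell_index m False False True sh) = p * (if sh then 1 else m)"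
    and "card (cell_index m True sl True sh) = (if sl then 1 else m) * m * (if sh then 1 else m)"
proof -
  have "cell_index m False False False False = {(a, b, c). a \<le> b \<and> b \<le> c \<and> c < m}"
    by (auto simp: cell_index_def)
  then show "card (cell_index m False False False False) = t"
    by (simp add: t_def)
  have "cell_index m True sl False False = {..<if sl then 1 else m} \<times> {(a, b). a \<le> b \<and> b < m}"
    by (auto simp: cell_index_def)
  then show "card (cell_index m True sl False False) = (if sl then 1 else m) * p"
    by (simp add: p_def card_cartesian_product)
  have "cell_index m False False True sh = (\<lambda>((a, b), c). (a, b, c)) ` ({(a, b). a \<le> b \<and> b < m} \<times> {..<if sh then 1 else m})"
    by (auto simp: cell_index_def image_iff)
  moreover have "inj_on (\<lambda>((a, b), c). (a, b, c)) ({(a, b). a \<le> b \<and> b < m} \<times> {..<if sh then 1 else m})"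
    by (auto simp: inj_on_def)
  ultimately show "card (cell_index m False False True sh) = p * (if sh then 1 else m)"
    by (simp add: p_def card_image card_cartesian_product)
  have "cell_index m True sl True sh = {..<if sl then 1 else m} \<times> {..<m} \<times> {..<if sh then 1 else m}"
    by (auto simp: cell_index_def)
  then show "card (cell_index m True sl True sh) = (if sl then 1 else m) * m * (if sh then 1 else m)"
    by (simp add: card_cartesian_product)
qed

section \<open>The two covers and the final count\<close>

lemma low_condition_cover:
  assumes "D \<subseteq> topspace (theta_graph m)"
  shows "low_condition False False D \<or> low_condition True True D"
proof (cases "South \<in> D")
  case True
  \<comment> \<open>All other points of the graph have positive height, so an occupied south pole is
    the strictly lowest point.\<close>
  have "height South < height q" if "q \<in> D" "q \<noteq> South" for q
    using that assms by (auto elim!: theta_graph_cases dest!: subsetD)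
  then show ?thesis using True unfolding low_condition_def by blast
qed (simp add: low_condition_def)

lemma high_condition_cover:
  assumes "D \<subseteq> topspace (theta_graph m)"
  shows "high_condition False False D \<or> high_condition True True D"
proof (cases "North \<in> D")
  case True
  have "height q < height North" if "q \<in> D" "q \<noteq> North" for q
    using that assms by (auto elim!: theta_graph_cases dest!: subsetD)
  then show ?thesis using True unfolding high_condition_def by blast
qed (simp add: high_condition_def)

lemma points_subset_theta_graph:
  assumes "c \<in> topspace (unordered_conf n X)"
  shows "(\<Union>x\<in>c. x ` {..<n}) \<subseteq> topspace X"
proof -
  obtain x where "c = perm_orbit n x" "x \<in> topspace (ordered_conf n X)"
    using assms by (auto simp: topspace_unordered_conf)
  then show ?thesis
    unfolding \<open>c = perm_orbit n x\<close> perm_orbit_points by (auto simp: topspace_ordered_conf)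
qed

text \<open>Forgetting the south condition gives the two members of the north cover and their
  intersection.\<close>

definition high_piece :: "nat \<Rightarrow> bool \<Rightarrow> bool \<Rightarrow> (nat \<Rightarrow> nat suspension_point) set set" where
  "high_piece m hi sh = {c \<in> topspace (unordered_conf 3 (theta_graph m)).
     high_condition hi sh (\<Union>x\<in>c. x ` {..<3})}"

lemma high_piece_eq_Un: "piece m False False hi sh \<union> piece m True True hi sh = high_piece m hi sh"
  using low_condition_cover[OF points_subset_theta_graph] unfolding piece_def high_piece_def by blast

text \<open>Mayer-Vietoris for the south cover under a fixed north condition. In the overlap a
  strictly lowest point exists but must avoid South, which is the subtracted piece.\<close>

lemma euler_characteristic_high_piece:
  assumes "sh \<longrightarrow> hi"
  shows "euler_characteristic_defined (subtopology (unordered_conf 3 (theta_graph m)) (high_piece m hi sh)) \<and>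
    euler_characteristic (subtopology (unordered_conf 3 (theta_graph m)) (high_piece m hi sh))
      = int (card (cell_index m False False hi sh)) + int (card (cell_index m True True hi sh))
        - int (card (cell_index m True False hi sh))"
proof -
  have Int: "piece m False False hi sh \<inter> piece m True True hi sh = piece m True False hi sh"
    by (auto simp: piece_def low_condition_def)
  have o: "openin (unordered_conf 3 (theta_graph m)) (piece m lo sl hi sh)" if "sl \<longrightarrow> lo" for lo sl
    by (rule openin_piece[OF that assms])
  have chi: "euler_characteristic_defined (subtopology (unordered_conf 3 (theta_graph m)) (piece m lo sl hi sh)) \<and>
    euler_characteristic (subtopology (unordered_conf 3 (theta_graph m)) (piece m lo sl hi sh))
      = int (card (cell_index m lo sl hi sh))" if "sl \<longrightarrow> lo" for lo sl
    by (rule euler_characteristic_piece[OF that assms])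
  show ?thesis
    using euler_characteristic_mayer_vietoris[OF o[of False False] o[of True True], unfolded Int high_piece_eq_Un]
      chi[of False False] chi[of True True] chi[where lo = True and sl = False] by simp
qed

lemma openin_high_piece:
  assumes "sh \<longrightarrow> hi"
  shows "openin (unordered_conf 3 (theta_graph m)) (high_piece m hi sh)"
  unfolding high_piece_eq_Un[symmetric] by (intro openin_Un openin_piece) (use assms in auto)

theorem theorem1p5:
  fixes m :: nat
  assumes "m \<ge> 1"
  shows "euler_characteristic_defined (unordered_conf 3 (theta_graph m)) \<and>
    real_of_int (euler_characteristic (unordered_conf 3 (theta_graph m)))
      = real m * (real m - 2) * (real m - 7) / 6"
proof -
  let ?X = "unordered_conf 3 (theta_graph m)"
  have Un: "high_piece m False False \<union> high_piece m True True = topspace ?X"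
    using high_condition_cover[OF points_subset_theta_graph] unfolding high_piece_def by blast
  have Int: "high_piece m False False \<inter> high_piece m True True = high_piece m True False"
    by (auto simp: high_piece_def high_condition_def)
  note chi = euler_characteristic_high_piece
  have MV: "euler_characteristic_defined ?X \<and> euler_characteristic ?X =
     euler_characteristic (subtopology ?X (high_piece m False False))
     + euler_characteristic (subtopology ?X (high_piece m True True))
     - euler_characteristic (subtopology ?X (high_piece m True False))"
    using euler_characteristic_mayer_vietoris[of ?X "high_piece m False False" "high_piece m True True",
        unfolded Un Int subtopology_topspace] openin_high_piece chi by blast
  define p where "p = int (card {(a, b). a \<le> b \<and> b < m})"
  define t where "t = int (card {(a, b, c). a \<le> b \<and> b \<le> c \<and> c < m})"
  define k where "k = int m"
  have p: "2 * p = k * (k + 1)"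
    using arg_cong[OF double_card_weakly_increasing_pairs[of m], of int] by (simp add: p_def k_def algebra_simps)
  have t: "6 * t = k * (k + 1) * (k + 2)"
    using arg_cong[OF card_weakly_increasing_triples[of m], of int] by (simp add: t_def k_def algebra_simps)
  \<comment> \<open>The three brackets belong to U2, V2 and U2 \<inter> V2; inside each, the terms
    belong to U1, V1 and U1 \<inter> V1.\<close>
  have "euler_characteristic ?X = (t + p - k * p) + (p + k - k * k) - (p * k + k * k - k * k * k)"
    using MV chi[where hi = False and sh = False and m = m] chi[where hi = True and sh = True and m = m] chi[where hi = True and sh = False and m = m]
    by (simp add: card_cell_index p_def t_def k_def)
  \<comment> \<open>Scaling by 6 and grouping exposes \<open>6 * t\<close> and \<open>2 * p\<close>,
    the integral forms in which the two counts are known.\<close>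
  then have "6 * euler_characteristic ?X = 6 * t + 6 * (2 * p) * (1 - k) + 6 * k - 12 * k * k + 6 * k * k * k"
    by (simp add: algebra_simps)
  then have "6 * euler_characteristic ?X = k * (k - 2) * (k - 7)"
    unfolding p t by (simp add: algebra_simps)
  then have "real_of_int (6 * euler_characteristic ?X) = real_of_int (k * (k - 2) * (k - 7))"
    by (rule arg_cong)
  then have "6 * real_of_int (euler_characteristic ?X) = real m * (real m - 2) * (real m - 7)"
    by (simp only: k_def of_int_mult of_int_diff of_int_numeral of_int_of_nat_eq)
  then show ?thesis
    using MV by simp
qed

end
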